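(* Let $D\ge 1$, $\alpha>0$, $a_\delta>0$, $b_\delta>0$ be fixed, let $(\mathbf y_n)_{n\ge 1}$ be a sequence of observations in $\mathbb R^D$, and for each $N\ge1$ let $\mathbf Y_N=[\mathbf y_1,\dots,\mathbf y_N]$ be the $D\times N$ matrix of the first $N$ observations. Let $K_N$ denote the random variable given by the latent subspace dimension in the Bayesian model described in the context, and let $\mathrm P[K_N=k\mid \mathbf Y_N,\alpha]$ be its posterior probabilities given $\mathbf Y_N$ with $\alpha$ fixed. Then $$\forall k\in\{0,\dots,D-1\},\qquad \limsup_{N\to\infty}\ \mathrm P[K_N=k\mid \mathbf Y_N,\alpha]<1,$$ and $$\limsup_{N\to\infty}\ \mathrm P[K_N=D\mid \mathbf Y_N,\alpha]>0 .$$
   Context: Model (BNP-PCA). For $n=1,\dots,N$, $\mathbf y_n=\mathbf P(\mathbf z_n\odot \mathbf x_n)+\mathbf e_n\in\mathbb R^D$, where $\odot$ is the entrywise product, and: - The noise vectors $\mathbf e_n$ are i.i.d. $\mathcal N(0,\sigma^2\mathbb I_D)$. - $\mathbf P=[\mathbf p_1,\dots,\mathbf p_D]$ is a $D\times D$ orthogonal matrix with prior the uniform (Haar) probability distribution on the orthogonal group $\mathcal O_D$. - $\mathbf Z=(z_{k,n})$ is a binary matrix with $N$ columns and a random number $K\in\{0,1,\dots,D\}$ of rows, each row being nonzero, considered up to permutation of its rows; $\mathbf z_n$ is the $n$-th column of $\mathbf Z$, extended by $z_{k,n}=0$ for $K<k\le D$. The prior on $\mathbf Z$ is the Indian buffet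 process with parameter $\alpha$, $$\mathrm P[\mathbf Z\mid\alpha]=\frac{\alpha^{K}e^{-\alpha\sum_{n=1}^N 1/n}}{\prod_{i=1}^{2^N-1}K_i!}\prod_{k=1}^{K}\frac{(N-m_k)!\,(m_k-1)!}{N!},$$ where $m_k=\sum_{n}z_{k,n}$, and $K_i$ is the number of rows of $\mathbf Z$ equal to the $i$-th nonzero binary vector ("history") in $\{0,1\}^N$. Matrices with $K>D$ rows are given probability $0$ (because of the orthogonality of $\mathbf P$). - Given $\sigma^2$ and scale parameters $\delta_1^2,\delta_2^2,\dots$, the coefficients $x_{k,n}$ are independent with $x_{k,n}\sim\mathcal N(0,\delta_k^2\sigma^2)$. - The $\delta_k^2$ are i.i.d. with the shifted inverse gamma density on $(0,\infty)$: $\displaystyle \frac{b_\delta^{a_\delta}}{\gamma(a_\delta,b_\delta)}\Big(\frac1{1+t}\Big)^{a_\delta+1}\exp\Big(-\frac{b_\delta}{1+t}\Big)$, where $\gamma(a,b)=\int_0^b t^{a-1}e^{-t}\,dt$ is the lower incomplete gamma function. - $\sigma^2$ has the (improper) Jeffreys prior with density $1/\sigma^2$ on $(0,\infty)$. The marginal likelihood $\mathrm p(\mathbf Y_N\mid \mathbf Z)$ is obtained by integrating the Gaussian likelihood of $\mathbf Y_N$ over the priors of $\mathbf X=(x_{k,n})$, $\mathbf P$, $(\delta_k^2)_{k\le K}$ and $\sigma^2$. The latent dimension $K_N$ is the number $K$ of rows of $\mathbf Z$, and $$\mathrm P[K_N=k\mid \mathbf Y_N,\alpha]=\frac{\sum_{\mathbf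 Z:\,K=k}\mathrm P[\mathbf Z\mid\alpha]\,\mathrm p(\mathbf Y_N\mid\mathbf Z)}{\sum_{k'=0}^{D}\sum_{\mathbf Z:\,K=k'}\mathrm P[\mathbf Z\mid\alpha]\,\mathrm p(\mathbf Y_N\mid\mathbf Z)},$$ the sums being over binary matrices up to row permutation. The observations are assumed such that this posterior is well defined, i.e. the denominator is positive and finite for every $N$. *)

theory Defs
  imports "HOL-Probability.Probability" "HOL-Library.Multiset"
begin

section \<open>Binary matrices and the Indian buffet process\<close>

text \<open>
  A row of a binary matrix with columns \<open>1, \<dots>, N\<close> is encoded by its support, a subset of
  \<open>{1..N}\<close>, so that \<open>m\<^sub>k\<close> is a cardinality. A matrix with no zero row is a list of histories;
  considered up to permutation of its rows, it is a multiset of histories, and \<open>K\<^sub>i\<close> is a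
  multiplicity.
\<close>

definition histories :: "nat \<Rightarrow> nat set set" where
  "histories N = {h. h \<subseteq> {1..N} \<and> h \<noteq> {}}"

definition binary_matrices :: "nat \<Rightarrow> nat \<Rightarrow> nat set multiset set" where
  "binary_matrices N K = {Z. size Z = K \<and> set_mset Z \<subseteq> histories N}"

definition ibp_prior :: "nat \<Rightarrow> real \<Rightarrow> nat \<Rightarrow> nat set multiset \<Rightarrow> real" where
  "ibp_prior D \<alpha> N Z =
     (if size Z \<le> D then
        \<alpha> ^ size Z * exp (- \<alpha> * (\<Sum>n=1..N. 1 / real n)) / (\<Prod>h\<in>histories N. fact (count Z h)) *
        (\<Prod>h\<in>#Z. fact (N - card h) * fact (card h - 1) / fact N)
      else 0)"


section \<open>Priors of the parameters\<close>

text \<open>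
  Left-invariant Borel probability measures concentrated on the orthogonal group. By compactness
  of the group there is exactly one, and it is also right-invariant.
\<close>

definition haar_orthogonal :: "(real^'d^'d) measure \<Rightarrow> bool" where
  "haar_orthogonal H \<longleftrightarrow>
     prob_space H \<and> sets H = sets borel \<and>
     (AE P in H. orthogonal_matrix P) \<and>
     (\<forall>Q. orthogonal_matrix Q \<longrightarrow> distr H borel (\<lambda>P. Q ** P) = H)"

definition lower_inc_Gamma :: "real \<Rightarrow> real \<Rightarrow> real" where
  "lower_inc_Gamma a b = (LBINT t:{0<..<b}. t powr (a - 1) * exp (- t))"

definition shifted_inverse_gamma :: "real \<Rightarrow> real \<Rightarrow> real measure" where
  "shifted_inverse_gamma a b =
     density lborel (\<lambda>t. ennreal (indicator {0<..} t *
       (b powr a / lower_inc_Gamma a b * (1 / (1 + t)) powr (a + 1) * exp (- b / (1 + t)))))"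

definition jeffreys_prior :: "real measure" where
  "jeffreys_prior = density lborel (\<lambda>s. ennreal (indicator {0<..} s * (1 / s)))"

text \<open>
  In what follows \<open>s\<close> stands for the noise variance \<open>\<sigma>\<^sup>2\<close> and \<open>d k\<close> for \<open>\<delta>\<^sub>k\<^sup>2\<close>; the second
  parameter of \<^const>\<open>normal_density\<close> is a standard deviation. Rows are numbered from \<open>0\<close>.
\<close>

definition coeff_prior :: "nat \<Rightarrow> nat \<Rightarrow> (nat \<Rightarrow> real) \<Rightarrow> real \<Rightarrow> (nat \<times> nat \<Rightarrow> real) measure" where
  "coeff_prior K N d s =
     (\<Pi>\<^sub>M (k, n) \<in> {..<K} \<times> {1..N}. density lborel (normal_density 0 (sqrt (d k * s))))"


section \<open>Likelihood and posterior\<close>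

text \<open>
  The dimension is \<open>D = CARD('d)\<close>. The coordinates of \<open>real^'d\<close>, hence the columns of a
  matrix \<open>P\<close>, are numbered \<open>0, \<dots>, D - 1\<close> by \<^term>\<open>to_nat_on (UNIV :: 'd set)\<close>; row \<open>k\<close> of the
  binary matrix switches on the column of \<open>P\<close> with number \<open>k\<close>. Rows with \<open>k \<ge> length Z\<close> are zero.
\<close>

definition masked_coeffs :: "nat set list \<Rightarrow> (nat \<times> nat \<Rightarrow> real) \<Rightarrow> nat \<Rightarrow> real^'d::finite" where
  "masked_coeffs Z x n =
     (\<chi> j. let k = to_nat_on (UNIV :: 'd set) j in of_bool (k < length Z \<and> n \<in> Z ! k) * x (k, n))"

definition likelihood ::
  "(nat \<Rightarrow> real^'d::finite) \<Rightarrow> nat \<Rightarrow> nat set list \<Rightarrow> real^'d^'d \<Rightarrow> (nat \<times> nat \<Rightarrow> real) \<Rightarrow> real \<Rightarrow> real"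
where
  "likelihood y N Z P x s =
     (\<Prod>n=1..N. \<Prod>i\<in>UNIV. normal_density ((P *v masked_coeffs Z x n) $ i) (sqrt s) (y n $ i))"

definition marginal_likelihood_rows ::
  "real \<Rightarrow> real \<Rightarrow> (real^'d^'d) measure \<Rightarrow> (nat \<Rightarrow> real^'d::finite) \<Rightarrow> nat \<Rightarrow> nat set list \<Rightarrow> ennreal"
where
  "marginal_likelihood_rows a b H y N Z =
     (\<integral>\<^sup>+ s. \<integral>\<^sup>+ d. \<integral>\<^sup>+ P. \<integral>\<^sup>+ x. ennreal (likelihood y N Z P x s)
        \<partial>coeff_prior (length Z) N d s
        \<partial>H
        \<partial>(\<Pi>\<^sub>M k\<in>{..<length Z}. shifted_inverse_gamma a b)
        \<partial>jeffreys_prior)"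

text \<open>
  The value does not depend on the order of the rows, since \<open>H\<close> is invariant under permutation
  of the columns; any representative of the multiset of rows may be used.
\<close>

definition marginal_likelihood ::
  "real \<Rightarrow> real \<Rightarrow> (real^'d^'d) measure \<Rightarrow> (nat \<Rightarrow> real^'d::finite) \<Rightarrow> nat \<Rightarrow> nat set multiset \<Rightarrow> ennreal"
where
  "marginal_likelihood a b H y N Z = marginal_likelihood_rows a b H y N (SOME rows. mset rows = Z)"

definition dimension_weight ::
  "real \<Rightarrow> real \<Rightarrow> real \<Rightarrow> (real^'d^'d) measure \<Rightarrow> (nat \<Rightarrow> real^'d::finite) \<Rightarrow> nat \<Rightarrow> nat \<Rightarrow> ennreal"
where
  "dimension_weight \<alpha> a b H y N k =
     (\<Sum>Z\<in>binary_matrices N k.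
        ennreal (ibp_prior CARD('d) \<alpha> N Z) * marginal_likelihood a b H y N Z)"

definition evidence ::
  "real \<Rightarrow> real \<Rightarrow> real \<Rightarrow> (real^'d^'d) measure \<Rightarrow> (nat \<Rightarrow> real^'d::finite) \<Rightarrow> nat \<Rightarrow> ennreal"
where
  "evidence \<alpha> a b H y N = (\<Sum>k=0..CARD('d). dimension_weight \<alpha> a b H y N k)"

definition posterior_dimension ::
  "real \<Rightarrow> real \<Rightarrow> real \<Rightarrow> (real^'d^'d) measure \<Rightarrow> (nat \<Rightarrow> real^'d::finite) \<Rightarrow> nat \<Rightarrow> nat \<Rightarrow> ennreal"
where
  "posterior_dimension \<alpha> a b H y N k = dimension_weight \<alpha> a b H y N k / evidence \<alpha> a b H y N"

end

theory Submission
  imports Defs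
begin

text \<open>
  Appending a row with a single one, in column \<open>n\<close>, to a matrix with fewer than \<open>D\<close> rows changes the
  law of \<open>y\<^sub>n\<close> only. Given \<open>\<delta>\<^sup>2 = t\<close> for the new row, completing the square in the new coefficient
  shows that the likelihood is multiplied by at least \<open>1 / sqrt (1 + t)\<close>, whatever the data, so the
  marginal likelihood is multiplied by at least the prior mean \<open>c > 0\<close> of this quantity. The
  Indian buffet prior is multiplied by at least \<open>\<alpha> / (N (k + 1))\<close>, there are \<open>N\<close> such rows to
  choose from, and a matrix with \<open>k + 1\<close> rows arises at most \<open>k + 1\<close> times. Hence the weights satisfy
  \<open>W\<^sub>k\<^sub>+\<^sub>1 \<ge> c \<alpha> (k + 1)\<^sup>-\<^sup>2 W\<^sub>k\<close> uniformly in \<open>N\<close>, and the posterior mass of \<open>K\<^sub>N = D\<close> is bounded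
  below.
\<close>

section \<open>Product measures and the Haar measure\<close>

text \<open>Both sides agree on boxes, because the integral of a product of one-variable functions
  factorises. Sigma-finiteness of each factor comes from its density being finite, not from its
  total mass, so normal densities with standard deviation 0 are covered as well.\<close>

lemma PiM_density_lborel:
  fixes f :: "'i \<Rightarrow> real \<Rightarrow> real"
  assumes "finite I" and [measurable]: "\<And>i. f i \<in> borel_measurable borel"
    and nonneg: "\<And>i x. 0 \<le> f i x"
  shows "PiM I (\<lambda>i. density lborel (f i)) = density (PiM I (\<lambda>_. lborel)) (\<lambda>x. \<Prod>i\<in>I. ennreal (f i (x i)))"
proof -
  interpret L: product_sigma_finite "\<lambda>_::'i. lborel :: real measure" by standard
  have "sigma_finite_measure (density lborel (f i))" for i
    by (subst sigma_finite_measure.sigma_finite_iff_density_finite[OF sigma_finite_lborel]) auto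
  then interpret F: product_sigma_finite "\<lambda>i. density lborel (f i)" by (rule product_sigma_finite.intro)
  have m: "(\<lambda>x. \<Prod>i\<in>I. ennreal (f i (x i))) \<in> borel_measurable (PiM I (\<lambda>_. lborel))"
    by measurable
  have "density (PiM I (\<lambda>_. lborel)) (\<lambda>x. \<Prod>i\<in>I. ennreal (f i (x i))) = PiM I (\<lambda>i. density lborel (f i))"
  proof (rule F.PiM_eqI[OF \<open>finite I\<close>])
    show "sets (density (PiM I (\<lambda>_. lborel)) (\<lambda>x. \<Prod>i\<in>I. ennreal (f i (x i)))) =
        sets (PiM I (\<lambda>i. density lborel (f i)))"
      by (simp cong: sets_PiM_cong)
    fix A assume "\<And>i. i \<in> I \<Longrightarrow> A i \<in> sets (density lborel (f i))"
    then have A: "A i \<in> sets lborel" if "i \<in> I" for i using that by auto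
    have "emeasure (density (PiM I (\<lambda>_. lborel)) (\<lambda>x. \<Prod>i\<in>I. ennreal (f i (x i)))) (Pi\<^sub>E I A)
        = (\<integral>\<^sup>+x. (\<Prod>i\<in>I. ennreal (f i (x i))) * indicator (Pi\<^sub>E I A) x \<partial>PiM I (\<lambda>_. lborel))"
      using m A \<open>finite I\<close> by (intro emeasure_density sets_PiM_I_finite) auto
    also have "\<dots> = (\<integral>\<^sup>+x. (\<Prod>i\<in>I. ennreal (f i (x i)) * indicator (A i) (x i)) \<partial>PiM I (\<lambda>_. lborel))"
    proof (rule nn_integral_cong)
      fix x assume "x \<in> space (PiM I (\<lambda>_. lborel :: real measure))"
      then have "indicator (Pi\<^sub>E I A) x = (\<Prod>i\<in>I. indicator (A i) (x i) :: ennreal)"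
        using \<open>finite I\<close> by (auto simp: indicator_def space_PiM PiE_iff)
      then show "(\<Prod>i\<in>I. ennreal (f i (x i))) * indicator (Pi\<^sub>E I A) x
          = (\<Prod>i\<in>I. ennreal (f i (x i)) * indicator (A i) (x i))"
        by (simp add: prod.distrib)
    qed
    also have "\<dots> = (\<Prod>i\<in>I. \<integral>\<^sup>+x. ennreal (f i x) * indicator (A i) x \<partial>lborel)"
      using A \<open>finite I\<close> by (intro L.product_nn_integral_prod) auto
    also have "\<dots> = (\<Prod>i\<in>I. emeasure (density lborel (f i)) (A i))"
      using A by (intro prod.cong refl emeasure_density[symmetric]) auto
    finally show "emeasure (density (PiM I (\<lambda>_. lborel)) (\<lambda>x. \<Prod>i\<in>I. ennreal (f i (x i)))) (Pi\<^sub>E I A)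
      = (\<Prod>i\<in>I. emeasure (density lborel (f i)) (A i))" .
  qed
  then show ?thesis by simp
qed

text \<open>The preimage of a box is the box with sides permuted by the inverse of \<open>p\<close>,
  and a product over \<open>I\<close> does not see the order of its factors. This is
  exchangeability, used both for the coefficients and for the scales.\<close>

lemma distr_PiM_permute:
  assumes "sigma_finite_measure M" "finite I" and p: "bij_betw p I I"
  shows "distr (PiM I (\<lambda>_. M)) (PiM I (\<lambda>_. M)) (\<lambda>x. \<lambda>i\<in>I. x (p i)) = PiM I (\<lambda>_. M)"
proof -
  interpret product_sigma_finite "\<lambda>_. M" using assms(1) by (intro product_sigma_finite.intro)
  have pI: "p i \<in> I" if "i \<in> I" for i
    using p that by (rule bij_betw_apply)
  have qI: "inv_into I p i \<in> I" if "i \<in> I" for i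
    using bij_betw_inv_into[OF p] that by (rule bij_betw_apply)
  have m: "(\<lambda>x. \<lambda>i\<in>I. x (p i)) \<in> measurable (PiM I (\<lambda>_. M)) (PiM I (\<lambda>_. M))"
    using pI by (intro measurable_restrict measurable_component_singleton) auto
  show ?thesis
  proof (rule PiM_eqI[OF assms(2)])
    fix A assume A: "\<And>i. i \<in> I \<Longrightarrow> A i \<in> sets M"
    have "(\<lambda>x. \<lambda>i\<in>I. x (p i)) -` Pi\<^sub>E I A \<inter> space (PiM I (\<lambda>_. M)) = Pi\<^sub>E I (\<lambda>i. A (inv_into I p i))"
    proof (intro set_eqI iffI)
      fix x assume x: "x \<in> (\<lambda>x. \<lambda>i\<in>I. x (p i)) -` Pi\<^sub>E I A \<inter> space (PiM I (\<lambda>_. M))"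
      have "x i \<in> A (inv_into I p i)" if "i \<in> I" for i
      proof -
        have "x (p (inv_into I p i)) \<in> A (inv_into I p i)" using x qI[OF that] by (auto simp: PiE_iff)
        then show ?thesis using bij_betw_inv_into_right[OF p that] by simp
      qed
      then show "x \<in> Pi\<^sub>E I (\<lambda>i. A (inv_into I p i))" using x by (auto simp: PiE_iff space_PiM)
    next
      fix x assume x: "x \<in> Pi\<^sub>E I (\<lambda>i. A (inv_into I p i))"
      have "x (p i) \<in> A i" if "i \<in> I" for i
        using PiE_mem[OF x pI[OF that]] bij_betw_inv_into_left[OF p that] by simp
      moreover have "x i \<in> space M" if "i \<in> I" for i
        using PiE_mem[OF x that] A[OF qI[OF that]] sets.sets_into_space by blast
      ultimately show "x \<in> (\<lambda>x. \<lambda>i\<in>I. x (p i)) -` Pi\<^sub>E I A \<inter> space (PiM I (\<lambda>_. M))"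
        using x by (auto simp: PiE_iff space_PiM)
    qed
    then have "emeasure (distr (PiM I (\<lambda>_. M)) (PiM I (\<lambda>_. M)) (\<lambda>x. \<lambda>i\<in>I. x (p i))) (Pi\<^sub>E I A)
        = (\<Prod>i\<in>I. emeasure M (A (inv_into I p i)))"
      using A assms(2) qI by (subst emeasure_distr[OF m]) (auto intro!: sets_PiM_I_finite emeasure_PiM)
    also have "\<dots> = (\<Prod>i\<in>I. emeasure M (A i))"
      by (rule prod.reindex_bij_betw[OF bij_betw_inv_into[OF p]])
    finally show "emeasure (distr (PiM I (\<lambda>_. M)) (PiM I (\<lambda>_. M)) (\<lambda>x. \<lambda>i\<in>I. x (p i))) (Pi\<^sub>E I A)
        = (\<Prod>i\<in>I. emeasure M (A i))" .
  qed simp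
qed

lemma nn_integral_PiM_permute:
  assumes "sigma_finite_measure M" "finite I" "bij_betw p I I"
    and [measurable]: "f \<in> borel_measurable (PiM I (\<lambda>_. M))"
  shows "(\<integral>\<^sup>+x. f (\<lambda>i\<in>I. x (p i)) \<partial>PiM I (\<lambda>_. M)) = integral\<^sup>N (PiM I (\<lambda>_. M)) f"
proof -
  have "(\<lambda>x. \<lambda>i\<in>I. x (p i)) \<in> measurable (PiM I (\<lambda>_. M)) (PiM I (\<lambda>_. M))"
    using bij_betw_apply[OF assms(3)] by (intro measurable_restrict measurable_component_singleton) auto
  then show ?thesis
    by (subst (2) distr_PiM_permute[OF assms(1-3), symmetric]) (simp add: nn_integral_distr)
qed

section \<open>Two-sided invariance of the Haar measure\<close>

lemma borel_measurable_matrix_mult_pair: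
  "(\<lambda>(P, R). transpose P ** R) \<in> borel_measurable (borel \<Otimes>\<^sub>M (borel :: (real^'d^'d::finite) measure))"
  unfolding borel_prod
  by (rule borel_measurable_continuous_onI)
     (auto simp: matrix_matrix_mult_def transpose_def split_beta intro!: continuous_intros)

lemma measurable_transpose [measurable]: "transpose \<in> borel_measurable (borel :: (real^'d^'d::finite) measure)"
  by (rule borel_measurable_continuous_onI) (auto simp: transpose_def[abs_def] intro!: continuous_intros)

lemma measurable_matrix_mult_left [measurable]:
  "(\<lambda>P. P ** Q) \<in> borel_measurable (borel :: (real^'d^'d::finite) measure)"
  by (rule borel_measurable_continuous_onI) (auto simp: matrix_matrix_mult_def intro!: continuous_intros)

lemma measurable_matrix_mult_right [measurable]:
  "(\<lambda>P. Q ** P) \<in> borel_measurable (borel :: (real^'d^'d::finite) measure)"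
  by (rule borel_measurable_continuous_onI) (auto simp: matrix_matrix_mult_def intro!: continuous_intros)

text \<open>
  Left invariance is applied under the first integral of \<open>f (P\<^sup>T R)\<close> over \<open>R\<close> and \<open>P\<close>, then, after
  Fubini, to \<open>f ((R\<^sup>T P)\<^sup>T)\<close>. Right invariance, needed to permute columns, follows.
\<close>

lemma haar_orthogonal_transpose:
  fixes H :: "(real^'d^'d::finite) measure"
  assumes "haar_orthogonal H"
  shows "distr H borel transpose = H"
proof -
  have prob: "prob_space H" and sets [measurable_cong, simp]: "sets H = sets borel"
    and orth: "AE P in H. orthogonal_matrix P"
    and inv: "\<And>Q. orthogonal_matrix Q \<Longrightarrow> distr H borel (\<lambda>P. Q ** P) = H"
    using assms by (auto simp: haar_orthogonal_def)
  interpret prob_space H by fact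
  interpret HH: pair_sigma_finite H H by standard
  have ms: "(\<lambda>(P, R). transpose P ** R) \<in> borel_measurable (H \<Otimes>\<^sub>M H)"
    using borel_measurable_matrix_mult_pair by (simp cong: measurable_cong_sets sets_pair_measure_cong)
  have left: "(\<integral>\<^sup>+R. f (Q ** R) \<partial>H) = integral\<^sup>N H f" if "orthogonal_matrix Q" "f \<in> borel_measurable borel" for f Q
    by (subst (2) inv[OF that(1), symmetric]) (use that in \<open>simp add: nn_integral_distr\<close>)
  show ?thesis
  proof (rule measure_eqI)
    fix A assume "A \<in> sets (distr H borel transpose)"
    then have A [measurable]: "A \<in> sets borel" by simp
    have m: "(\<lambda>(P, R). indicator A (transpose P ** R) :: ennreal) \<in> borel_measurable (H \<Otimes>\<^sub>M H)"
      using measurable_compose[OF ms, of "indicator A" borel] A by (simp add: case_prod_unfold)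
    have tm: "(\<lambda>P. indicator A (transpose P) :: ennreal) \<in> borel_measurable borel"
      using A by measurable
    have "emeasure H A = (\<integral>\<^sup>+P. (\<integral>\<^sup>+R. indicator A R \<partial>H) \<partial>H)"
      using A by (simp add: emeasure_space_1)
    also have "\<dots> = (\<integral>\<^sup>+P. (\<integral>\<^sup>+R. indicator A (transpose P ** R) \<partial>H) \<partial>H)"
    proof (rule nn_integral_cong_AE)
      show "AE P in H. (\<integral>\<^sup>+R. indicator A R \<partial>H) = (\<integral>\<^sup>+R. indicator A (transpose P ** R) \<partial>H)"
        using orth
      proof eventually_elim
        case (elim P)
        then show ?case using left[of "transpose P" "indicator A"] A by simp
      qed
    qed
    also have "\<dots> = (\<integral>\<^sup>+R. (\<integral>\<^sup>+P. indicator A (transpose P ** R) \<partial>H) \<partial>H)"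
      using HH.Fubini'[OF m] by simp
    also have "\<dots> = (\<integral>\<^sup>+R. (\<integral>\<^sup>+P. indicator A (transpose P) \<partial>H) \<partial>H)"
    proof (rule nn_integral_cong_AE)
      show "AE R in H. (\<integral>\<^sup>+P. indicator A (transpose P ** R) \<partial>H) = (\<integral>\<^sup>+P. indicator A (transpose P) \<partial>H)"
        using orth
      proof eventually_elim
        case (elim R)
        then have "(\<integral>\<^sup>+P. indicator A (transpose (transpose R ** P)) \<partial>H) = (\<integral>\<^sup>+P. indicator A (transpose P) \<partial>H)"
          using left[of "transpose R" "\<lambda>P. indicator A (transpose P)"] tm by simp
        then show ?case by (simp add: matrix_transpose_mul)
      qed
    qed
    also have "\<dots> = (\<integral>\<^sup>+P. indicator A (transpose P) \<partial>H)"
      by (simp add: emeasure_space_1)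
    also have "\<dots> = emeasure (distr H borel transpose) A"
      using A by (subst nn_integral_distr[of transpose H borel "indicator A", symmetric]) auto
    finally show "emeasure (distr H borel transpose) A = emeasure H A" by simp
  qed simp
qed

text \<open>Transposition turns left multiplication by \<open>transpose Q\<close> into right
  multiplication by \<open>Q\<close>, and it preserves \<open>H\<close>.\<close>

lemma haar_orthogonal_right_invariant:
  fixes H :: "(real^'d^'d::finite) measure"
  assumes H: "haar_orthogonal H" and Q: "orthogonal_matrix Q" and f [measurable]: "f \<in> borel_measurable borel"
  shows "(\<integral>\<^sup>+P. f (P ** Q) \<partial>H) = integral\<^sup>N H f"
proof -
  have [measurable_cong, simp]: "sets H = sets borel"
    and inv: "distr H borel (\<lambda>P. transpose Q ** P) = H"
    using H Q by (auto simp: haar_orthogonal_def)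
  have t: "(\<integral>\<^sup>+P. g (transpose P) \<partial>H) = integral\<^sup>N H g" if "g \<in> borel_measurable borel" for g
    by (subst (2) haar_orthogonal_transpose[OF H, symmetric]) (use that in \<open>simp add: nn_integral_distr\<close>)
  have "integral\<^sup>N H f = (\<integral>\<^sup>+P. f (transpose P) \<partial>H)"
    using t[OF f] by simp
  also have "\<dots> = (\<integral>\<^sup>+P. f (transpose (transpose Q ** P)) \<partial>H)"
    by (subst inv[symmetric]) (simp add: nn_integral_distr)
  also have "\<dots> = (\<integral>\<^sup>+P. f (transpose P ** Q) \<partial>H)"
    by (simp add: matrix_transpose_mul)
  also have "\<dots> = (\<integral>\<^sup>+P. f (P ** Q) \<partial>H)"
    using t[of "\<lambda>P. f (P ** Q)"] by simp
  finally show ?thesis by simp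
qed


section \<open>Gaussian integrals and the priors of the scales\<close>

lemma nn_integral_normal_density:
  "0 < \<sigma> \<Longrightarrow> (\<integral>\<^sup>+x. ennreal (normal_density \<mu> \<sigma> x) \<partial>lborel) = 1"
  using prob_space.emeasure_space_1[OF prob_space_normal_density] by (simp add: emeasure_density)

text \<open>In Bayesian terms: a centred normal prior of variance \<open>t * s\<close> times a
  Gaussian likelihood factor of precision \<open>1 / s\<close> is an unnormalised normal density of
  variance \<open>t * s / (1 + t)\<close>. The ratio of the normalising constants is
  \<open>1 / sqrt (1 + t)\<close>.\<close>

lemma normal_density_complete_square:
  assumes "0 < s" "0 < t"
  shows "exp (w * a - w\<^sup>2 / (2 * s)) * normal_density 0 (sqrt (t * s)) w
    = 1 / sqrt (1 + t) * exp (a\<^sup>2 * (t * s / (1 + t)) / 2)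
      * normal_density (a * (t * s / (1 + t))) (sqrt (t * s / (1 + t))) w"
proof -
  define v where "v = t * s / (1 + t)"
  have v: "v > 0" "t * s = v * (1 + t)" using assms by (auto simp: v_def field_simps)
  \<comment> \<open>The precisions of likelihood and prior add up.\<close>
  have s: "1 / s + 1 / (t * s) = 1 / v" using assms by (simp add: v_def field_simps)
  have "w * a - w\<^sup>2 / (2 * s) - w\<^sup>2 / (2 * (t * s)) = w * a - w\<^sup>2 / 2 * (1 / s + 1 / (t * s))"
    using assms by (simp add: field_simps)
  also have "\<dots> = a\<^sup>2 * v / 2 - (w - a * v)\<^sup>2 / (2 * v)"
    unfolding s using v(1) by (simp add: field_simps power2_eq_square)
  finally have e: "exp (w * a - w\<^sup>2 / (2 * s)) * exp (- w\<^sup>2 / (2 * (t * s)))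
      = exp (a\<^sup>2 * v / 2) * exp (- (w - a * v)\<^sup>2 / (2 * v))"
    by (simp add: exp_add[symmetric])
  have q: "sqrt (2 * pi * (t * s)) = sqrt (2 * pi * v) * sqrt (1 + t)"
    unfolding v(2) by (simp add: real_sqrt_mult)
  have "exp (w * a - w\<^sup>2 / (2 * s)) * normal_density 0 (sqrt (t * s)) w
     = (exp (w * a - w\<^sup>2 / (2 * s)) * exp (- w\<^sup>2 / (2 * (t * s)))) / sqrt (2 * pi * (t * s))"
    using assms by (simp add: normal_density_def)
  also have "\<dots> = 1 / sqrt (1 + t) * exp (a\<^sup>2 * v / 2) * normal_density (a * v) (sqrt v) w"
    unfolding e q using v(1) by (simp add: normal_density_def)
  finally show ?thesis unfolding v_def .
qed

text \<open>Expanding the squared distance from \<open>y\<close> to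
  \<open>\<mu> + w *\<^sub>R p\<close> leaves a cross term, linear in \<open>w\<close>, and a
  quadratic term, which does not depend on the direction \<open>p\<close> because \<open>p\<close>
  is a unit vector.\<close>

lemma prod_normal_density_shift:
  fixes p \<mu> y :: "real^'d::finite"
  assumes "0 < s" "p \<bullet> p = 1"
  shows "(\<Prod>i\<in>UNIV. normal_density ((\<mu> + w *\<^sub>R p) $ i) (sqrt s) (y $ i))
    = (\<Prod>i\<in>UNIV. normal_density (\<mu> $ i) (sqrt s) (y $ i)) * exp (w * (((y - \<mu>) \<bullet> p) / s) - w\<^sup>2 / (2 * s))"
proof -
  have "normal_density ((\<mu> + w *\<^sub>R p) $ i) (sqrt s) (y $ i)
      = normal_density (\<mu> $ i) (sqrt s) (y $ i) * exp (w / s * ((y - \<mu>) $ i * p $ i) - w\<^sup>2 / (2 * s) * (p $ i * p $ i))" for i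
  proof -
    have "- (y $ i - (\<mu> + w *\<^sub>R p) $ i)\<^sup>2 / (2 * s)
        = - (y $ i - \<mu> $ i)\<^sup>2 / (2 * s) + (w / s * ((y - \<mu>) $ i * p $ i) - w\<^sup>2 / (2 * s) * (p $ i * p $ i))"
      using assms(1) by (simp add: field_simps power2_eq_square)
    moreover have "normal_density m (sqrt s) x = 1 / sqrt (2 * pi * s) * exp (- (x - m)\<^sup>2 / (2 * s))" for m x
      using assms(1) by (simp add: normal_density_def)
    ultimately show ?thesis by (simp only: exp_add mult.assoc)
  qed
  moreover have "(\<Sum>i\<in>UNIV. w / s * ((y - \<mu>) $ i * p $ i) - w\<^sup>2 / (2 * s) * (p $ i * p $ i))
      = w * (((y - \<mu>) \<bullet> p) / s) - w\<^sup>2 / (2 * s)"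
    using assms(2) unfolding inner_vec_def sum_subtractf sum_distrib_left[symmetric] by simp
  ultimately show ?thesis
    by (simp add: prod.distrib exp_sum[symmetric] del: vector_add_component vector_minus_component)
qed

text \<open>The integral over \<open>w\<close> equals the old likelihood times
  \<open>exp (a\<^sup>2 * v / 2) / sqrt (1 + t)\<close>. The data enter this factor only through the
  exponential, which is at least 1; dropping it gives a bound uniform in the data.\<close>

lemma prod_normal_density_marginal_ge:
  fixes p \<mu> y :: "real^'d::finite"
  assumes "0 < s" "0 < t" "p \<bullet> p = 1"
  shows "ennreal (1 / sqrt (1 + t)) * ennreal (\<Prod>i\<in>UNIV. normal_density (\<mu> $ i) (sqrt s) (y $ i))
    \<le> (\<integral>\<^sup>+w. ennreal ((\<Prod>i\<in>UNIV. normal_density ((\<mu> + w *\<^sub>R p) $ i) (sqrt s) (y $ i))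
          * normal_density 0 (sqrt (t * s)) w) \<partial>lborel)"
proof -
  define L where "L = (\<Prod>i\<in>UNIV. normal_density (\<mu> $ i) (sqrt s) (y $ i))"
  define a where "a = ((y - \<mu>) \<bullet> p) / s"
  define v where "v = t * s / (1 + t)"
  have L: "0 \<le> L" unfolding L_def by (intro prod_nonneg) simp
  have v: "0 < v" using assms by (simp add: v_def)
  have "(\<integral>\<^sup>+w. ennreal ((\<Prod>i\<in>UNIV. normal_density ((\<mu> + w *\<^sub>R p) $ i) (sqrt s) (y $ i))
          * normal_density 0 (sqrt (t * s)) w) \<partial>lborel)
     = (\<integral>\<^sup>+w. ennreal (L * (1 / sqrt (1 + t) * exp (a\<^sup>2 * v / 2)) * normal_density (a * v) (sqrt v) w) \<partial>lborel)"
    unfolding prod_normal_density_shift[OF assms(1,3)] L_def[symmetric] a_def[symmetric] mult.assoc[of L]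
      normal_density_complete_square[OF assms(1,2)] v_def by simp
  also have "\<dots> = ennreal (L * (1 / sqrt (1 + t) * exp (a\<^sup>2 * v / 2)))"
    using L assms v
    by (subst ennreal_mult'[OF mult_nonneg_nonneg]) (simp_all add: nn_integral_cmult nn_integral_normal_density)
  also have "\<dots> \<ge> ennreal (1 / sqrt (1 + t) * L)"
  proof (rule ennreal_leI)
    have "1 \<le> exp (a\<^sup>2 * v / 2)" using v by simp
    from mult_left_mono[OF this, of "1 / sqrt (1 + t) * L"] show "1 / sqrt (1 + t) * L \<le> L * (1 / sqrt (1 + t) * exp (a\<^sup>2 * v / 2))"
      using L assms by (simp add: mult_ac)
  qed
  moreover have "ennreal (1 / sqrt (1 + t)) * ennreal L = ennreal (1 / sqrt (1 + t) * L)"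
    using assms by (intro ennreal_mult'[symmetric]) simp
  ultimately show ?thesis
    unfolding L_def[symmetric] by simp
qed

section \<open>The scale prior and its mean of \<open>1 / sqrt (1 + t)\<close>\<close>

lemma not_AE_lborel_notin_interval:
  assumes "0 < (b::real)"
  shows "\<not> (AE t in lborel. t \<notin> {0<..<b})"
proof
  assume "AE t in lborel. t \<notin> {0<..<b}"
  then have "emeasure lborel {0<..<b} = 0"
    by (subst (asm) AE_iff_measurable[of "{0<..<b}"]) auto
  then show False using assms by simp
qed

text \<open>A Bochner integral has the default value 0 when the integrand is not integrable, so
  integrability has to be settled before positivity.\<close>

lemma lower_inc_Gamma_pos:
  assumes "0 < a" "0 < b"
  shows "0 < lower_inc_Gamma a b"
proof -
  let ?f = "\<lambda>t::real. indicator {0<..<b} t * (t powr (a - 1) * exp (- t))"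
  \<comment> \<open>Comparison with the complete Gamma integral; this handles the singularity at 0
    when \<open>a < 1\<close>.\<close>
  have int: "(\<integral>\<^sup>+t. ennreal (?f t) \<partial>lborel) < \<infinity>"
  proof -
    have "(\<integral>\<^sup>+t. ennreal (?f t) \<partial>lborel) \<le> (\<integral>\<^sup>+t. ennreal (indicator {0..} t * (t powr (a - 1) / exp t)) \<partial>lborel)"
      by (intro nn_integral_mono ennreal_leI) (auto simp: indicator_def exp_minus divide_inverse)
    also have "\<dots> = ennreal (Gamma a)" using Gamma_conv_nn_integral_real[OF assms(1)] by simp
    finally show ?thesis by (rule le_less_trans) simp
  qed
  have "integrable lborel ?f"
    using int by (intro integrableI_nonneg) auto
  moreover have "\<not> (AE t in lborel. ?f t = 0)"
  proof
    assume "AE t in lborel. ?f t = 0"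
    then have "AE t in lborel. t \<notin> {0<..<b}" by eventually_elim (auto simp: indicator_def split: if_splits)
    then show False using not_AE_lborel_notin_interval assms(2) by blast
  qed
  ultimately have "0 < integral\<^sup>L lborel ?f"
    by (subst less_le) (auto simp: integral_nonneg_eq_0_iff_AE)
  then show ?thesis by (simp add: lower_inc_Gamma_def set_lebesgue_integral_def)
qed

lemma sets_shifted_inverse_gamma [measurable_cong, simp]: "sets (shifted_inverse_gamma a b) = sets borel"
  by (simp add: shifted_inverse_gamma_def)

lemma sigma_finite_shifted_inverse_gamma: "sigma_finite_measure (shifted_inverse_gamma a b)"
  unfolding shifted_inverse_gamma_def
  by (subst sigma_finite_measure.sigma_finite_iff_density_finite[OF sigma_finite_lborel]) auto

lemma AE_shifted_inverse_gamma_pos: "AE t in shifted_inverse_gamma a b. 0 < t"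
  unfolding shifted_inverse_gamma_def by (subst AE_density) (auto simp: indicator_def)

lemma sets_jeffreys_prior [measurable_cong, simp]: "sets jeffreys_prior = sets borel"
  by (simp add: jeffreys_prior_def)

lemma AE_jeffreys_prior_pos: "AE s in jeffreys_prior. 0 < s"
  unfolding jeffreys_prior_def by (subst AE_density) (auto simp: indicator_def)

text \<open>The constant c of the overview: the guaranteed likelihood factor of a new row, averaged
  over the prior of its scale. It involves neither \<open>N\<close> nor the data.\<close>

definition dimension_cost :: "real \<Rightarrow> real \<Rightarrow> ennreal" where
  "dimension_cost a b = (\<integral>\<^sup>+t. ennreal (1 / sqrt (1 + t)) \<partial>shifted_inverse_gamma a b)"

text \<open>Integrand and prior density are both positive on the positive half-line, so a zero mean
  would make that half-line a Lebesgue null set.\<close>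

lemma dimension_cost_pos:
  assumes "0 < a" "0 < b"
  shows "0 < dimension_cost a b"
proof -
  have G: "0 < lower_inc_Gamma a b" using assms by (rule lower_inc_Gamma_pos)
  have "dimension_cost a b \<noteq> 0"
  proof
    assume "dimension_cost a b = 0"
    then have "AE t in shifted_inverse_gamma a b. ennreal (1 / sqrt (1 + t)) = 0"
      unfolding dimension_cost_def by (subst (asm) nn_integral_0_iff_AE) auto
    \<comment> \<open>The integrand vanishes in \<open>ennreal\<close> exactly for
      \<open>t \<le> -1\<close>; the weaker \<open>t \<le> 0\<close> is enough for the
      contradiction.\<close>
    then have "AE t in shifted_inverse_gamma a b. t \<le> 0"
      by eventually_elim (auto simp: ennreal_eq_0_iff)
    then have "AE t in lborel. 0 < ennreal (indicator {0<..} t *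
       (b powr a / lower_inc_Gamma a b * (1 / (1 + t)) powr (a + 1) * exp (- b / (1 + t)))) \<longrightarrow> t \<le> 0"
      unfolding shifted_inverse_gamma_def by (subst (asm) AE_density) auto
    then have "AE t in lborel. \<not> (0 < (t::real))"
    proof eventually_elim
      case (elim t)
      show ?case
      proof
        assume t: "0 < t"
        then have "0 < b powr a / lower_inc_Gamma a b * (1 / (1 + t)) powr (a + 1) * exp (- b / (1 + t))"
          using G assms by simp
        then show False using elim t by simp
      qed
    qed
    then have "AE t in lborel. t \<notin> {0<..<(1::real)}" by eventually_elim simp
    then show False using not_AE_lborel_notin_interval[of 1] by simp
  qed
  then show ?thesis by (simp add: zero_less_iff_neq_zero)
qed


section \<open>Invariance of the marginal likelihood under row permutations\<close>

text \<open>
  With \<^const>\<open>coeff_prior\<close> written as a density with respect to a fixed measure, the integral over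
  the coefficients is measurable in the variances by the usual Fubini argument.
\<close>

definition coeff_density :: "nat \<Rightarrow> nat \<Rightarrow> (nat \<Rightarrow> real) \<Rightarrow> real \<Rightarrow> (nat \<times> nat \<Rightarrow> real) \<Rightarrow> real" where
  "coeff_density K N d s x = (\<Prod>i\<in>{..<K} \<times> {1..N}. normal_density 0 (sqrt (d (fst i) * s)) (x i))"

definition integrated_likelihood ::
  "(nat \<Rightarrow> real^'d::finite) \<Rightarrow> nat \<Rightarrow> nat set list \<Rightarrow> real \<Rightarrow> (nat \<Rightarrow> real) \<Rightarrow> real^'d^'d \<Rightarrow> ennreal"
where
  "integrated_likelihood y N Z s d P =
     (\<integral>\<^sup>+x. ennreal (coeff_density (length Z) N d s x * likelihood y N Z P x s)
        \<partial>PiM ({..<length Z} \<times> {1..N}) (\<lambda>_. lborel))"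

lemma coeff_density_nonneg: "0 \<le> coeff_density K N d s x"
  unfolding coeff_density_def by (intro prod_nonneg) simp

section \<open>Joint measurability in the parameters\<close>

lemma measurable_normal_density [measurable (raw)]:
  assumes [measurable]: "\<mu> \<in> borel_measurable M" "\<sigma> \<in> borel_measurable M" "x \<in> borel_measurable M"
  shows "(\<lambda>w. normal_density (\<mu> w) (\<sigma> w) (x w)) \<in> borel_measurable M"
  unfolding normal_density_def by measurable

lemma measurable_matrix_entry:
  assumes "P \<in> borel_measurable M"
  shows "(\<lambda>w. (P w :: real^'d^'d::finite) $ i $ j) \<in> borel_measurable M"
proof -
  have "(\<lambda>P::real^'d^'d. P $ i $ j) \<in> borel_measurable borel"
    by (rule borel_measurable_continuous_onI) (intro continuous_intros)
  from measurable_compose[OF assms this] show ?thesis .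
qed

lemma measurable_likelihood:
  fixes y :: "nat \<Rightarrow> real^'d::finite"
  assumes P: "P \<in> borel_measurable M" and [measurable]: "s \<in> borel_measurable M"
    and x: "x \<in> measurable M (PiM ({..<length Z} \<times> {1..N}) (\<lambda>_. lborel))"
  shows "(\<lambda>w. likelihood y N Z (P w) (x w) (s w)) \<in> borel_measurable M"
proof -
  \<comment> \<open>An entry that is switched on is a coordinate of the product space; any other
    entry is the constant 0, even if its index lies outside that space.\<close>
  have c: "(\<lambda>w. masked_coeffs Z (x w) n $ j) \<in> borel_measurable M" if "n \<in> {1..N}" for n and j :: 'd
  proof (cases "to_nat_on (UNIV :: 'd set) j < length Z \<and> n \<in> Z ! to_nat_on (UNIV :: 'd set) j")
    case True
    have "(\<lambda>x. x (to_nat_on (UNIV :: 'd set) j, n)) \<in>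
        measurable (PiM ({..<length Z} \<times> {1..N}) (\<lambda>_. lborel)) (lborel :: real measure)"
      using True that by (intro measurable_component_singleton) auto
    from measurable_compose[OF x this] show ?thesis using True by (simp add: masked_coeffs_def)
  qed (auto simp: masked_coeffs_def)
  have "(\<lambda>w. (P w *v masked_coeffs Z (x w) n) $ i) \<in> borel_measurable M" if "n \<in> {1..N}" for n i
    unfolding matrix_vector_mult_def vec_lambda_beta
    using c[OF that] by (intro borel_measurable_sum borel_measurable_times measurable_matrix_entry[OF P])
  then show ?thesis
    unfolding likelihood_def by (intro borel_measurable_prod measurable_normal_density) auto
qed

lemma measurable_coeff_density:
  assumes d: "d \<in> measurable M (PiM {..<K} (\<lambda>_. borel))" and [measurable]: "s \<in> borel_measurable M"
    and x: "x \<in> measurable M (PiM ({..<K} \<times> {1..N}) (\<lambda>_. lborel))"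
  shows "(\<lambda>w. coeff_density K N (d w) (s w) (x w)) \<in> borel_measurable M"
  unfolding coeff_density_def
proof (intro borel_measurable_prod)
  fix i assume i: "i \<in> {..<K} \<times> {1..N}"
  have [measurable]: "(\<lambda>w. d w (fst i)) \<in> borel_measurable M"
    using i by (intro measurable_compose[OF d measurable_component_singleton]) auto
  have "(\<lambda>w. x w i) \<in> measurable M lborel"
    using i by (intro measurable_compose[OF x measurable_component_singleton]) auto
  then have [measurable]: "(\<lambda>w. x w i) \<in> borel_measurable M" by simp
  show "(\<lambda>w. normal_density 0 (sqrt (d w (fst i) * s w)) (x w i)) \<in> borel_measurable M"
    by measurable
qed

text \<open>Stated along arbitrary measurable functions of a parameter \<open>w\<close>, so that it
  serves for \<open>P\<close>, for the scales and for \<open>s\<close>, one at a time or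
  jointly.\<close>

lemma measurable_integrated_likelihood:
  fixes y :: "nat \<Rightarrow> real^'d::finite"
  assumes P: "P \<in> borel_measurable M" and s: "s \<in> borel_measurable M"
    and d: "d \<in> measurable M (PiM {..<length Z} (\<lambda>_. borel))"
  shows "(\<lambda>w. integrated_likelihood y N Z (s w) (d w) (P w)) \<in> borel_measurable M"
proof -
  let ?X = "PiM ({..<length Z} \<times> {1..N}) (\<lambda>_. lborel) :: (nat \<times> nat \<Rightarrow> real) measure"
  interpret L: product_sigma_finite "\<lambda>_::nat \<times> nat. lborel :: real measure" by standard
  interpret X: sigma_finite_measure ?X by (rule L.sigma_finite) simp
  have "case_prod (\<lambda>w x. ennreal (coeff_density (length Z) N (d w) (s w) x * likelihood y N Z (P w) x (s w)))
      \<in> borel_measurable (M \<Otimes>\<^sub>M ?X)"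
    unfolding case_prod_unfold
    by (intro measurable_compose[OF _ measurable_ennreal] borel_measurable_times measurable_coeff_density
        measurable_likelihood measurable_snd measurable_compose[OF measurable_fst] P s d)
  from X.borel_measurable_nn_integral[OF this] show ?thesis
    unfolding integrated_likelihood_def .
qed

text \<open>The innermost integrals agree for every \<open>s\<close> and \<open>d\<close>,
  degenerate variances included, so no null set has to be discarded here.\<close>

lemma marginal_likelihood_rows_eq:
  fixes y :: "nat \<Rightarrow> real^'d::finite"
  shows "marginal_likelihood_rows a b H y N Z =
     (\<integral>\<^sup>+ s. \<integral>\<^sup>+ d. \<integral>\<^sup>+ P. integrated_likelihood y N Z s d P \<partial>H
        \<partial>(\<Pi>\<^sub>M k\<in>{..<length Z}. shifted_inverse_gamma a b) \<partial>jeffreys_prior)"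
proof -
  have "(\<integral>\<^sup>+ x. ennreal (likelihood y N Z P x s) \<partial>coeff_prior (length Z) N d s)
      = integrated_likelihood y N Z s d P" for P s d
  proof -
    let ?I = "{..<length Z} \<times> {1..N}"
    have "coeff_prior (length Z) N d s
        = PiM ?I (\<lambda>i. density lborel (normal_density 0 (sqrt (d (fst i) * s))))"
      by (simp add: coeff_prior_def case_prod_unfold)
    also have "\<dots> = density (PiM ?I (\<lambda>_. lborel)) (\<lambda>x. \<Prod>i\<in>?I. ennreal (normal_density 0 (sqrt (d (fst i) * s)) (x i)))"
      by (rule PiM_density_lborel) auto
    also have "\<dots> = density (PiM ?I (\<lambda>_. lborel)) (\<lambda>x. ennreal (coeff_density (length Z) N d s x))"
      unfolding coeff_density_def by (simp add: prod_ennreal)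
    finally have "coeff_prior (length Z) N d s =
        density (PiM ?I (\<lambda>_. lborel)) (\<lambda>x. ennreal (coeff_density (length Z) N d s x))" .
    moreover have "(\<lambda>x. coeff_density (length Z) N d s x) \<in> borel_measurable (PiM ?I (\<lambda>_. lborel))"
      unfolding coeff_density_def by measurable
    moreover have "(\<lambda>x. likelihood y N Z P x s) \<in> borel_measurable (PiM ?I (\<lambda>_. lborel))"
      by (intro measurable_likelihood) auto
    ultimately show ?thesis
      by (simp add: nn_integral_density integrated_likelihood_def ennreal_mult' coeff_density_nonneg)
  qed
  then show ?thesis by (simp add: marginal_likelihood_rows_def)
qed

text \<open>The permutation matrix for which column number k of
  \<open>P ** column_permutation p\<close> is column number \<open>p k\<close> of
  \<open>P\<close>.\<close>

definition column_permutation :: "(nat \<Rightarrow> nat) \<Rightarrow> real^'d^'d::finite" where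
  "column_permutation p =
     (\<chi> i j. of_bool (to_nat_on (UNIV :: 'd set) i = p (to_nat_on (UNIV :: 'd set) j)))"

text \<open>Let \<open>\<tau>\<close> be \<open>p\<close> transported to the index type. Injectivity
  of \<open>\<tau>\<close> gives orthonormal columns. The premise of the second claim says that
  \<open>v\<close> is the transposed permutation matrix applied to \<open>u\<close>, so the two
  permutations cancel; in coordinates, a sum is reindexed by \<open>\<tau>\<close>.\<close>

lemma
  fixes p :: "nat \<Rightarrow> nat" and P :: "real^'d^'d::finite"
  assumes "p permutes {..<CARD('d)}"
  shows orthogonal_column_permutation: "orthogonal_matrix (column_permutation p :: real^'d^'d)"
    and column_permutation_mult: "(\<And>j. v $ j = u $ (inv_into UNIV (to_nat_on UNIV) (p (to_nat_on UNIV j)))) \<Longrightarrow>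
      (P ** column_permutation p) *v v = P *v u"
proof -
  let ?e = "to_nat_on (UNIV :: 'd set)"
  have e: "bij_betw ?e UNIV {..<CARD('d)}" by (rule to_nat_on_finite) simp
  define \<tau> where "\<tau> j = inv_into UNIV ?e (p (?e j))" for j :: 'd
  have e\<tau>: "?e (\<tau> j) = p (?e j)" for j
    unfolding \<tau>_def using bij_betw_apply[OF e, of j] permutes_in_image[OF assms]
    by (intro bij_betw_inv_into_right[OF e]) auto
  have inj_e: "?e i = ?e j \<longleftrightarrow> i = j" for i j
    using bij_betw_imp_inj_on[OF e] by (auto simp: inj_on_def)
  have Q: "column_permutation p $ i $ j = (of_bool (i = \<tau> j) :: real)" for i j
    by (simp add: column_permutation_def e\<tau>[symmetric] inj_e)
  have inj: "\<tau> i = \<tau> j \<longleftrightarrow> i = j" for i j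
    using e\<tau> inj_e permutes_inj[OF assms] by (metis injD)
  have "(\<Sum>k\<in>UNIV. of_bool (k = \<tau> i) * of_bool (k = \<tau> j)) = (\<Sum>k\<in>UNIV. if k = \<tau> i then of_bool (i = j) else (0 :: real))"
    for i j by (rule sum.cong) (auto simp: inj)
  then have "transpose (column_permutation p) ** column_permutation p = (mat 1 :: real^'d^'d)"
    by (simp add: vec_eq_iff matrix_matrix_mult_def transpose_def Q mat_def)
  then show "orthogonal_matrix (column_permutation p :: real^'d^'d)" by (simp add: orthogonal_matrix)
  have bij: "bij_betw \<tau> UNIV UNIV"
    using finite_UNIV_inj_surj[OF finite, of \<tau>] inj by (simp add: bij_betw_def inj_def)
  assume uv: "\<And>j. v $ j = u $ (inv_into UNIV ?e (p (?e j)))"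
  have PQ: "(P ** column_permutation p) $ a $ j = P $ a $ \<tau> j" for a j
    by (simp add: matrix_matrix_mult_def Q of_bool_def if_distrib cong: if_cong)
  have "(\<Sum>j\<in>UNIV. P $ a $ \<tau> j * u $ \<tau> j) = (\<Sum>j\<in>UNIV. P $ a $ j * u $ j)" for a
    by (rule sum.reindex_bij_betw[OF bij, of "\<lambda>j. P $ a $ j * u $ j"])
  then show "(P ** column_permutation p) *v v = P *v u"
    unfolding vec_eq_iff matrix_vector_mult_def PQ vec_lambda_beta uv \<tau>_def[symmetric] by blast
qed

text \<open>Relabelling the rows is undone by relabelling the scales, the columns of
  \<open>P\<close> and the coefficients simultaneously. The coefficients are integrated against
  Lebesgue measure, for which their relabelling is a change of variables.\<close>

lemma integrated_likelihood_permute: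
  fixes y :: "nat \<Rightarrow> real^'d::finite"
  assumes p: "p permutes {..<length Z}" and len: "length Z \<le> CARD('d)"
  shows "integrated_likelihood y N (permute_list p Z) s (\<lambda>i\<in>{..<length Z}. d (p i)) (P ** column_permutation p)
    = integrated_likelihood y N Z s d P"
proof -
  let ?e = "to_nat_on (UNIV :: 'd set)"
  let ?I = "{..<length Z} \<times> {1..N}"
  \<comment> \<open>Permutes the row index of a coefficient and keeps its observation index.\<close>
  define q where "q = map_prod p (id :: nat \<Rightarrow> nat)"
  have e: "bij_betw ?e UNIV {..<CARD('d)}" by (rule to_nat_on_finite) simp
  \<comment> \<open>Since \<open>p\<close> fixes all numbers from \<open>length Z\<close> on, it
    also permutes the D column numbers; this is where \<open>len\<close> enters.\<close>
  have pD: "p permutes {..<CARD('d)}" using permutes_subset[OF p] len by simp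
  have pK: "p k < length Z \<longleftrightarrow> k < length Z" for k using permutes_in_image[OF p, of k] by simp
  have pinj: "p i = p j \<longleftrightarrow> i = j" for i j using permutes_inj[OF p] by (auto simp: inj_def)
  have q: "bij_betw q ?I ?I"
  proof -
    have "inj_on q ?I" by (auto simp: q_def inj_on_def pinj)
    moreover have "q ` ?I = p ` {..<length Z} \<times> {1..N}" by (simp add: q_def map_prod_image)
    ultimately show ?thesis using permutes_image[OF p] by (simp add: bij_betw_def)
  qed
  have fin: "finite ?I" by simp
  let ?d = "\<lambda>i\<in>{..<length Z}. d (p i)"
  have lik: "likelihood y N (permute_list p Z) (P ** column_permutation p) (\<lambda>i\<in>?I. x (q i)) s
      = likelihood y N Z P x s" for x
  proof -
    have "(P ** column_permutation p) *v masked_coeffs (permute_list p Z) (\<lambda>i\<in>?I. x (q i)) n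
        = P *v masked_coeffs Z x n" if "n \<in> {1..N}" for n
    proof (rule column_permutation_mult[OF pD])
      fix j :: 'd
      have ej: "?e (inv_into UNIV ?e (p (?e j))) = p (?e j)"
        using bij_betw_apply[OF e, of j] permutes_in_image[OF pD]
        by (intro bij_betw_inv_into_right[OF e]) auto
      show "masked_coeffs (permute_list p Z) (\<lambda>i\<in>?I. x (q i)) n $ j
          = masked_coeffs Z x n $ inv_into UNIV ?e (p (?e j))"
      proof (cases "?e j < length Z")
        case True
        then have "(?e j, n) \<in> ?I" using that by simp
        with True show ?thesis
          by (simp only: masked_coeffs_def vec_lambda_beta Let_def ej pK length_permute_list
              permute_list_nth[OF p True] restrict_apply' q_def map_prod_simp id_apply)
      next
        case False
        then show ?thesis by (simp add: masked_coeffs_def ej pK)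
      qed
    qed
    then show ?thesis unfolding likelihood_def by (intro prod.cong refl) auto
  qed
  have coeff: "coeff_density (length Z) N ?d s (\<lambda>i\<in>?I. x (q i)) = coeff_density (length Z) N d s x" for x
  proof -
    have "coeff_density (length Z) N ?d s (\<lambda>i\<in>?I. x (q i))
        = (\<Prod>i\<in>?I. normal_density 0 (sqrt (d (fst (q i)) * s)) (x (q i)))"
      unfolding coeff_density_def by (intro prod.cong refl) (auto simp: q_def)
    also have "\<dots> = coeff_density (length Z) N d s x"
      unfolding coeff_density_def by (rule prod.reindex_bij_betw[OF q])
    finally show ?thesis .
  qed
  have m: "(\<lambda>x. ennreal (coeff_density (length Z) N ?d s x *
       likelihood y N (permute_list p Z) (P ** column_permutation p) x s)) \<in> borel_measurable (PiM ?I (\<lambda>_. lborel))"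
  proof -
    have "(\<lambda>x. coeff_density (length Z) N ?d s x) \<in> borel_measurable (PiM ?I (\<lambda>_. lborel))"
      unfolding coeff_density_def by measurable
    moreover have "(\<lambda>x. likelihood y N (permute_list p Z) (P ** column_permutation p) x s)
        \<in> borel_measurable (PiM ?I (\<lambda>_. lborel))"
      by (intro measurable_likelihood) auto
    ultimately show ?thesis by measurable
  qed
  show ?thesis
    unfolding integrated_likelihood_def length_permute_list
    using nn_integral_PiM_permute[OF sigma_finite_lborel fin q m] by (simp only: lik coeff)
qed

lemma measurable_integral_integrated_likelihood:
  assumes "sigma_finite_measure H" and H: "sets H = sets borel"
    and s: "s \<in> borel_measurable M" and d: "d \<in> measurable M (PiM {..<length Z} (\<lambda>_. borel))"
  shows "(\<lambda>w. \<integral>\<^sup>+P. integrated_likelihood y N Z (s w) (d w) P \<partial>H) \<in> borel_measurable M"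
proof -
  interpret H: sigma_finite_measure H by fact
  note [measurable_cong] = H
  show ?thesis
    by (rule H.borel_measurable_nn_integral, unfold case_prod_unfold)
       (intro measurable_integrated_likelihood measurable_compose[OF measurable_fst] s d, measurable)
qed

lemma sets_PiM_shifted_inverse_gamma:
  "sets (\<Pi>\<^sub>M k\<in>I. shifted_inverse_gamma a b) = sets (PiM I (\<lambda>_. borel))"
  by (simp cong: sets_PiM_cong)

text \<open>Right invariance of \<open>H\<close> supplies the permutation of the columns, and the
  scales being identically distributed and independent supplies that of \<open>d\<close>. What
  remains is \<open>integrated_likelihood_permute\<close> under the integrals.\<close>

lemma marginal_likelihood_rows_permute:
  fixes y :: "nat \<Rightarrow> real^'d::finite"
  assumes H: "haar_orthogonal H" and p: "p permutes {..<length Z}" and len: "length Z \<le> CARD('d)"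
  shows "marginal_likelihood_rows a b H y N (permute_list p Z) = marginal_likelihood_rows a b H y N Z"
proof -
  let ?G = "\<Pi>\<^sub>M k\<in>{..<length Z}. shifted_inverse_gamma a b"
  let ?d = "\<lambda>d. \<lambda>i\<in>{..<length Z}. d (p i)"
  have [simp]: "sets H = sets borel" and "prob_space H"
    using H by (auto simp: haar_orthogonal_def)
  interpret H: prob_space H by fact
  have pD: "p permutes {..<CARD('d)}" using permutes_subset[OF p] len by simp
  have P: "(\<integral>\<^sup>+P. integrated_likelihood y N (permute_list p Z) s d P \<partial>H)
      = (\<integral>\<^sup>+P. integrated_likelihood y N (permute_list p Z) s d (P ** column_permutation p) \<partial>H)"
    if "d \<in> space (PiM {..<length Z} (\<lambda>_. borel))" for s d
    using that by (intro haar_orthogonal_right_invariant[OF H orthogonal_column_permutation[OF pD], symmetric]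
        measurable_integrated_likelihood) auto
  have "(\<integral>\<^sup>+d. \<integral>\<^sup>+P. integrated_likelihood y N (permute_list p Z) s d P \<partial>H \<partial>?G)
      = (\<integral>\<^sup>+d. \<integral>\<^sup>+P. integrated_likelihood y N Z s d P \<partial>H \<partial>?G)" for s
  proof -
    have "(\<lambda>d. \<integral>\<^sup>+P. integrated_likelihood y N (permute_list p Z) s d P \<partial>H) \<in> borel_measurable ?G"
      using sets_PiM_shifted_inverse_gamma
      by (intro measurable_integral_integrated_likelihood H.sigma_finite_measure_axioms) (auto intro: measurable_ident_sets)
    from nn_integral_PiM_permute[OF sigma_finite_shifted_inverse_gamma _ permutes_imp_bij[OF p] this, symmetric]
    have "(\<integral>\<^sup>+d. \<integral>\<^sup>+P. integrated_likelihood y N (permute_list p Z) s d P \<partial>H \<partial>?G)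
        = (\<integral>\<^sup>+d. \<integral>\<^sup>+P. integrated_likelihood y N (permute_list p Z) s (?d d) P \<partial>H \<partial>?G)"
      by simp
    also have "\<dots> = (\<integral>\<^sup>+d. \<integral>\<^sup>+P. integrated_likelihood y N Z s d P \<partial>H \<partial>?G)"
    proof (rule nn_integral_cong)
      fix d :: "nat \<Rightarrow> real"
      have "?d d \<in> space (PiM {..<length Z} (\<lambda>_. borel))" by (simp add: space_PiM)
      from P[OF this] show "(\<integral>\<^sup>+P. integrated_likelihood y N (permute_list p Z) s (?d d) P \<partial>H)
          = (\<integral>\<^sup>+P. integrated_likelihood y N Z s d P \<partial>H)"
        by (simp only: integrated_likelihood_permute[OF p len])
    qed
    finally show ?thesis .
  qed
  then show ?thesis by (simp add: marginal_likelihood_rows_eq)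
qed


section \<open>Adding a singleton row\<close>

lemma orthogonal_matrix_column_inner:
  fixes P :: "real^'d^'d::finite"
  assumes "orthogonal_matrix P"
  shows "column j P \<bullet> column j P = 1"
  using assms by (simp add: orthogonal_matrix_orthonormal_columns norm_eq_1)

text \<open>The new row brings \<open>N\<close> new coefficients, of which only the one at
  \<open>n\<close> reaches the likelihood, where it shifts the mean of \<open>y n\<close> along a
  unit vector, a column of \<open>P\<close>. The other new coefficients integrate to 1, and
  \<open>prod_normal_density_marginal_ge\<close> applies for each value of the old
  coefficients.\<close>

lemma integrated_likelihood_add_singleton_ge:
  fixes y :: "nat \<Rightarrow> real^'d::finite"
  assumes len: "length Z < CARD('d)" and n: "n \<in> {1..N}" and s: "0 < s" and t: "0 < t"
    and P: "orthogonal_matrix P"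
  shows "ennreal (1 / sqrt (1 + t)) * integrated_likelihood y N Z s d P
    \<le> integrated_likelihood y N (Z @ [{n}]) s (d(length Z := t)) P"
proof -
  let ?e = "to_nat_on (UNIV :: 'd set)"
  define K where "K = length Z"
  \<comment> \<open>\<open>I\<close> indexes the old coefficients and \<open>J\<close> those of the
    new row.\<close>
  define I where "I = {..<K} \<times> {1..N}"
  define J where "J = {K} \<times> {1..N}"
  \<comment> \<open>The coordinate with number \<open>K\<close>, which exists because
    \<open>K\<close> is below D: rows are numbered from 0, so the new row uses a free
    column.\<close>
  define j0 where "j0 = inv_into UNIV ?e K"
  define p where "p = column j0 P"
  \<comment> \<open>\<open>g\<close> is the density of \<open>y n\<close> with its mean shifted by
    the new coefficient, \<open>R\<close> collects the other observations, and \<open>h\<close>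
    splits the integrand over the coordinates of the new row.\<close>
  define g where "g x w = (\<Prod>i\<in>UNIV. normal_density (((P *v masked_coeffs Z x n) + w *\<^sub>R p) $ i) (sqrt s) (y n $ i))" for x w
  define R where "R x = (\<Prod>m\<in>{1..N}-{n}. \<Prod>i\<in>UNIV. normal_density ((P *v masked_coeffs Z x m) $ i) (sqrt s) (y m $ i))" for x
  define h where "h x i u = ennreal (normal_density 0 (sqrt (t * s)) u * (if i = (K, n) then g x u else 1))" for x i u
  interpret L: product_sigma_finite "\<lambda>_::nat \<times> nat. lborel :: real measure" by standard
  have e: "bij_betw ?e UNIV {..<CARD('d)}" by (rule to_nat_on_finite) simp
  have ej0: "?e j0 = K" unfolding j0_def using len by (intro bij_betw_inv_into_right[OF e]) (simp add: K_def)
  have e_eq: "?e j = K \<longleftrightarrow> j = j0" for j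
    using ej0 bij_betw_imp_inj_on[OF e] by (auto simp: inj_on_def)
  have IJ: "I \<inter> J = {}" "finite I" "finite J" "{..<length (Z @ [{n}])} \<times> {1..N} = I \<union> J"
    by (auto simp: I_def J_def K_def)
  have pp: "p \<bullet> p = 1" using P by (simp add: p_def orthogonal_matrix_column_inner)
  have R: "0 \<le> R x" and g: "0 \<le> g x w" for x w by (auto simp: R_def g_def intro!: prod_nonneg)
  have g_meas [measurable]: "g x \<in> borel_measurable borel" for x
    unfolding g_def by simp measurable

  have masked: "masked_coeffs (Z @ [{n}]) (merge I J (x, w)) m
      = masked_coeffs Z x m + (if m = n then w (K, n) else 0) *\<^sub>R (axis j0 1 :: real^'d)"
    if "m \<in> {1..N}" for x w m
  proof -
    have "masked_coeffs (Z @ [{n}]) (merge I J (x, w)) m $ j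
      = masked_coeffs Z x m $ j + (if m = n then w (K, n) else 0) * (axis j0 1 :: real^'d) $ j" for j
    proof (cases "?e j < K")
      case True
      then have "(?e j, m) \<in> I" "j \<noteq> j0" using that ej0 by (auto simp: I_def)
      with True show ?thesis
        by (simp add: masked_coeffs_def merge_def nth_append K_def[symmetric] axis_def)
    next
      case False
      show ?thesis
      proof (cases "j = j0")
        case True
        have "(K, m) \<in> J" "(K, m) \<notin> I" using that by (auto simp: I_def J_def)
        then show ?thesis
          unfolding True by (simp add: masked_coeffs_def merge_def nth_append K_def[symmetric] axis_def ej0)
      next
        case neq: False
        then have "\<not> ?e j < Suc K" using False e_eq by (auto simp: less_Suc_eq)
        then show ?thesis using neq False
          by (simp add: masked_coeffs_def nth_append K_def[symmetric] axis_def)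
      qed
    qed
    then show ?thesis by (simp add: vec_eq_iff)
  qed
  have Pmasked: "P *v masked_coeffs (Z @ [{n}]) (merge I J (x, w)) m
      = P *v masked_coeffs Z x m + (if m = n then w (K, n) else 0) *\<^sub>R p"
    if "m \<in> {1..N}" for x w m
    unfolding masked[OF that] by (simp add: p_def matrix_vector_right_distrib matrix_vector_mult_basis
        matrix_vector_mult_scaleR)
  have prod_n: "(\<Prod>m=1..N. f m) = (\<Prod>m\<in>{1..N}-{n}. f m) * f n" for f :: "nat \<Rightarrow> real"
    using n by (subst prod.remove[of _ n]) (auto simp: mult.commute)
  have lik': "likelihood y N (Z @ [{n}]) P (merge I J (x, w)) s = R x * g x (w (K, n))" for x w
  proof -
    have "(\<Prod>m\<in>{1..N}-{n}. \<Prod>i\<in>UNIV. normal_density ((P *v masked_coeffs (Z @ [{n}]) (merge I J (x, w)) m) $ i) (sqrt s) (y m $ i)) = R x"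
      unfolding R_def by (intro prod.cong refl) (simp add: Pmasked)
    then show ?thesis unfolding likelihood_def prod_n g_def using Pmasked[OF n] by simp
  qed
  have lik: "likelihood y N Z P x s = R x * (\<Prod>i\<in>UNIV. normal_density ((P *v masked_coeffs Z x n) $ i) (sqrt s) (y n $ i))" for x
    unfolding likelihood_def prod_n R_def by simp
  have coeff: "coeff_density (length (Z @ [{n}])) N (d(length Z := t)) s (merge I J (x, w))
      = coeff_density K N d s x * (\<Prod>i\<in>J. normal_density 0 (sqrt (t * s)) (w i))" for x w
  proof -
    have "(\<Prod>i\<in>I. normal_density 0 (sqrt ((d(length Z := t)) (fst i) * s)) (merge I J (x, w) i)) = coeff_density K N d s x"
      unfolding coeff_density_def I_def[symmetric] by (intro prod.cong refl) (auto simp: I_def K_def merge_def)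
    moreover have "(\<Prod>i\<in>J. normal_density 0 (sqrt ((d(length Z := t)) (fst i) * s)) (merge I J (x, w) i))
        = (\<Prod>i\<in>J. normal_density 0 (sqrt (t * s)) (w i))"
      using IJ(1) by (intro prod.cong refl) (auto simp: J_def K_def merge_def)
    ultimately show ?thesis
      unfolding coeff_density_def[of "length (Z @ [{n}])"] IJ(4) using IJ(1-3) by (simp add: prod.union_disjoint)
  qed
  have Kn: "(K, n) \<in> J" using n by (simp add: J_def)
  have inner: "(\<integral>\<^sup>+w. ennreal (coeff_density (length (Z @ [{n}])) N (d(length Z := t)) s (merge I J (x, w))
        * likelihood y N (Z @ [{n}]) P (merge I J (x, w)) s) \<partial>PiM J (\<lambda>_. lborel))
      = ennreal (coeff_density K N d s x * R x) * (\<integral>\<^sup>+u. ennreal (g x u * normal_density 0 (sqrt (t * s)) u) \<partial>lborel)" for x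
  proof -
    have eq: "ennreal (coeff_density (length (Z @ [{n}])) N (d(length Z := t)) s (merge I J (x, w))
        * likelihood y N (Z @ [{n}]) P (merge I J (x, w)) s)
      = ennreal (coeff_density K N d s x * R x) * (\<Prod>i\<in>J. h x i (w i))" for w
    proof -
      have "(\<Prod>i\<in>J. h x i (w i)) = ennreal (\<Prod>i\<in>J. normal_density 0 (sqrt (t * s)) (w i) * (if i = (K, n) then g x (w i) else 1))"
        unfolding h_def using g by (intro prod_ennreal) auto
      also have "\<dots> = ennreal ((\<Prod>i\<in>J. normal_density 0 (sqrt (t * s)) (w i)) * g x (w (K, n)))"
        using Kn IJ(3) by (simp add: prod.distrib)
      finally show ?thesis
        unfolding coeff lik' using R coeff_density_nonneg
        by (simp add: ennreal_mult'[symmetric] mult_ac)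
    qed
    have h_meas: "h x i \<in> borel_measurable lborel" for i unfolding h_def by measurable
    have "(\<integral>\<^sup>+w. (\<Prod>i\<in>J. h x i (w i)) \<partial>PiM J (\<lambda>_. lborel)) = (\<Prod>i\<in>J. integral\<^sup>N lborel (h x i))"
      using h_meas by (intro L.product_nn_integral_prod IJ)
    \<comment> \<open>Away from \<open>(K, n)\<close> the factor is a bare normal density, of total
      mass 1.\<close>
    also have "\<dots> = (\<Prod>i\<in>J. if i = (K, n) then \<integral>\<^sup>+u. ennreal (g x u * normal_density 0 (sqrt (t * s)) u) \<partial>lborel else 1)"
      using s t by (intro prod.cong refl) (auto simp: h_def[abs_def] nn_integral_normal_density mult.commute)
    also have "\<dots> = (\<integral>\<^sup>+u. ennreal (g x u * normal_density 0 (sqrt (t * s)) u) \<partial>lborel)"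
      using Kn IJ(3) by simp
    finally have prod: "(\<integral>\<^sup>+w. (\<Prod>i\<in>J. h x i (w i)) \<partial>PiM J (\<lambda>_. lborel))
        = (\<integral>\<^sup>+u. ennreal (g x u * normal_density 0 (sqrt (t * s)) u) \<partial>lborel)" .
    have "(\<lambda>w. \<Prod>i\<in>J. h x i (w i)) \<in> borel_measurable (PiM J (\<lambda>_. lborel))"
      by (intro borel_measurable_prod_ennreal measurable_compose[OF measurable_component_singleton[of _ _ "\<lambda>_. lborel"] h_meas])
    then show ?thesis unfolding eq by (simp add: nn_integral_cmult prod)
  qed
  have meas: "(\<lambda>x. ennreal (coeff_density (length (Z @ [{n}])) N (d(length Z := t)) s x
        * likelihood y N (Z @ [{n}]) P x s)) \<in> borel_measurable (PiM (I \<union> J) (\<lambda>_. lborel))"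
  proof -
    have "(\<lambda>x. likelihood y N (Z @ [{n}]) P x s) \<in> borel_measurable (PiM (I \<union> J) (\<lambda>_. lborel))"
      unfolding IJ(4)[symmetric] by (intro measurable_likelihood) auto
    moreover have "(\<lambda>x. coeff_density (length (Z @ [{n}])) N (d(length Z := t)) s x) \<in> borel_measurable (PiM (I \<union> J) (\<lambda>_. lborel))"
      unfolding coeff_density_def IJ(4) by measurable
    ultimately show ?thesis by measurable
  qed
  have meas0: "(\<lambda>x. ennreal (coeff_density K N d s x * likelihood y N Z P x s)) \<in> borel_measurable (PiM I (\<lambda>_. lborel))"
  proof -
    have "(\<lambda>x. likelihood y N Z P x s) \<in> borel_measurable (PiM I (\<lambda>_. lborel))"
      unfolding I_def K_def by (intro measurable_likelihood) auto
    moreover have "(\<lambda>x. coeff_density K N d s x) \<in> borel_measurable (PiM I (\<lambda>_. lborel))"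
      unfolding coeff_density_def I_def[symmetric] by measurable
    ultimately show ?thesis by measurable
  qed
  have "integrated_likelihood y N (Z @ [{n}]) s (d(length Z := t)) P
      = (\<integral>\<^sup>+x. ennreal (coeff_density K N d s x * R x)
          * (\<integral>\<^sup>+u. ennreal (g x u * normal_density 0 (sqrt (t * s)) u) \<partial>lborel) \<partial>PiM I (\<lambda>_. lborel))"
    unfolding integrated_likelihood_def IJ(4) L.product_nn_integral_fold[OF IJ(1-3) meas] inner ..
  also have "\<dots> \<ge> (\<integral>\<^sup>+x. ennreal (1 / sqrt (1 + t)) * ennreal (coeff_density K N d s x * likelihood y N Z P x s) \<partial>PiM I (\<lambda>_. lborel))"
  proof (rule nn_integral_mono)
    fix x
    let ?l = "\<Prod>i\<in>UNIV. normal_density ((P *v masked_coeffs Z x n) $ i) (sqrt s) (y n $ i)"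
    have "ennreal (coeff_density K N d s x * likelihood y N Z P x s) = ennreal (coeff_density K N d s x * R x) * ennreal ?l"
      unfolding lik using R coeff_density_nonneg by (simp add: ennreal_mult'[symmetric] mult_ac)
    then have "ennreal (1 / sqrt (1 + t)) * ennreal (coeff_density K N d s x * likelihood y N Z P x s)
        = ennreal (coeff_density K N d s x * R x) * (ennreal (1 / sqrt (1 + t)) * ennreal ?l)"
      by (simp only: mult_ac)
    also have "\<dots> \<le> ennreal (coeff_density K N d s x * R x)
        * (\<integral>\<^sup>+u. ennreal (g x u * normal_density 0 (sqrt (t * s)) u) \<partial>lborel)"
      unfolding g_def by (intro mult_left_mono prod_normal_density_marginal_ge s t pp) simp
    finally show "ennreal (1 / sqrt (1 + t)) * ennreal (coeff_density K N d s x * likelihood y N Z P x s)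
        \<le> ennreal (coeff_density K N d s x * R x)
          * (\<integral>\<^sup>+u. ennreal (g x u * normal_density 0 (sqrt (t * s)) u) \<partial>lborel)" .
  qed
  finally show ?thesis
    using meas0 by (simp add: nn_integral_cmult integrated_likelihood_def I_def K_def)
qed

text \<open>The pointwise bound is integrated over \<open>P\<close>, then over the new scale, which
  turns \<open>1 / sqrt (1 + t)\<close> into \<open>dimension_cost\<close>, then over the old scales
  and \<open>s\<close>. Matrices that are not orthogonal and nonpositive \<open>t\<close> or
  \<open>s\<close> form null sets.\<close>

lemma marginal_likelihood_rows_add_singleton_ge:
  fixes y :: "nat \<Rightarrow> real^'d::finite"
  assumes H: "haar_orthogonal H" and len: "length Z < CARD('d)" and n: "n \<in> {1..N}"
  shows "dimension_cost a b * marginal_likelihood_rows a b H y N Z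
    \<le> marginal_likelihood_rows a b H y N (Z @ [{n}])"
proof -
  let ?S = "shifted_inverse_gamma a b"
  let ?K = "length Z"
  let ?F = "\<lambda>s d. \<integral>\<^sup>+P. integrated_likelihood y N Z s d P \<partial>H"
  let ?F' = "\<lambda>s d. \<integral>\<^sup>+P. integrated_likelihood y N (Z @ [{n}]) s d P \<partial>H"
  have setsH [simp]: "sets H = sets borel" and "prob_space H" and orth: "AE P in H. orthogonal_matrix P"
    using H by (auto simp: haar_orthogonal_def)
  interpret H: prob_space H by fact
  note [measurable_cong] = setsH
  interpret S: product_sigma_finite "\<lambda>_::nat. ?S"
    by (intro product_sigma_finite.intro sigma_finite_shifted_inverse_gamma)
  interpret SK: sigma_finite_measure "PiM {..<?K} (\<lambda>_. ?S)" by (rule S.sigma_finite) simp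
  have mP: "integrated_likelihood y N Z s d \<in> borel_measurable H" if "d \<in> space (PiM {..<?K} (\<lambda>_. borel))" for s d
    using measurable_integrated_likelihood[of "\<lambda>P. P" H "\<lambda>_. s" "\<lambda>_. d" Z y N] that by simp
  have m_id: "(\<lambda>d. d) \<in> measurable (PiM I (\<lambda>_. ?S)) (PiM I (\<lambda>_. borel))" for I
    using sets_PiM_shifted_inverse_gamma by (rule measurable_ident_sets)
  have mF: "(\<lambda>d. ?F s d) \<in> borel_measurable (PiM {..<?K} (\<lambda>_. ?S))" for s
    by (intro measurable_integral_integrated_likelihood H.sigma_finite_measure_axioms m_id) auto
  have mF': "(\<lambda>d. ?F' s d) \<in> borel_measurable (PiM (insert ?K {..<?K}) (\<lambda>_. ?S))" for s
    using m_id[of "insert ?K {..<?K}"]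
    by (intro measurable_integral_integrated_likelihood H.sigma_finite_measure_axioms) (auto simp: lessThan_Suc)
  have mG: "(\<lambda>s. \<integral>\<^sup>+d. ?F s d \<partial>PiM {..<?K} (\<lambda>_. ?S)) \<in> borel_measurable jeffreys_prior"
    by (rule SK.borel_measurable_nn_integral, unfold case_prod_unfold)
       (intro measurable_integral_integrated_likelihood H.sigma_finite_measure_axioms
         measurable_compose[OF measurable_snd m_id], auto)
  have F: "ennreal (1 / sqrt (1 + t)) * ?F s d \<le> ?F' s (d(?K := t))"
    if s: "0 < s" and t: "0 < t" and d: "d \<in> space (PiM {..<?K} (\<lambda>_. ?S))" for s t d
  proof -
    have "d \<in> space (PiM {..<?K} (\<lambda>_. borel))" using d by (simp add: space_PiM PiE_iff)
    then have "ennreal (1 / sqrt (1 + t)) * ?F s d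
        = (\<integral>\<^sup>+P. ennreal (1 / sqrt (1 + t)) * integrated_likelihood y N Z s d P \<partial>H)"
      by (intro nn_integral_cmult[symmetric] mP)
    also have "\<dots> \<le> ?F' s (d(?K := t))"
      by (intro nn_integral_mono_AE eventually_mono[OF orth] integrated_likelihood_add_singleton_ge[OF len n s t])
    finally show ?thesis .
  qed
  have "dimension_cost a b * (\<integral>\<^sup>+d. ?F s d \<partial>PiM {..<?K} (\<lambda>_. ?S))
      \<le> (\<integral>\<^sup>+d. ?F' s d \<partial>PiM {..<length (Z @ [{n}])} (\<lambda>_. ?S))" if s: "0 < s" for s
  proof -
    have "dimension_cost a b * (\<integral>\<^sup>+d. ?F s d \<partial>PiM {..<?K} (\<lambda>_. ?S))
        = (\<integral>\<^sup>+d. \<integral>\<^sup>+t. ennreal (1 / sqrt (1 + t)) * ?F s d \<partial>?S \<partial>PiM {..<?K} (\<lambda>_. ?S))"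
      using mF[of s] by (simp add: nn_integral_cmult nn_integral_multc dimension_cost_def)
    also have "\<dots> \<le> (\<integral>\<^sup>+d. \<integral>\<^sup>+t. ?F' s (d(?K := t)) \<partial>?S \<partial>PiM {..<?K} (\<lambda>_. ?S))"
    proof (rule nn_integral_mono)
      fix d assume "d \<in> space (PiM {..<?K} (\<lambda>_. ?S))"
      then show "(\<integral>\<^sup>+t. ennreal (1 / sqrt (1 + t)) * ?F s d \<partial>?S) \<le> (\<integral>\<^sup>+t. ?F' s (d(?K := t)) \<partial>?S)"
        by (intro nn_integral_mono_AE eventually_mono[OF AE_shifted_inverse_gamma_pos] F[OF s])
    qed
    \<comment> \<open>The new scale is the coordinate with index \<open>?K\<close> of the longer
      product.\<close>
    also have "\<dots> = (\<integral>\<^sup>+d. ?F' s d \<partial>PiM (insert ?K {..<?K}) (\<lambda>_. ?S))"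
      by (rule S.product_nn_integral_insert[symmetric]) (auto intro: mF')
    finally show ?thesis by (simp add: lessThan_Suc)
  qed
  then have "(\<integral>\<^sup>+s. dimension_cost a b * (\<integral>\<^sup>+d. ?F s d \<partial>PiM {..<?K} (\<lambda>_. ?S)) \<partial>jeffreys_prior)
      \<le> (\<integral>\<^sup>+s. (\<integral>\<^sup>+d. ?F' s d \<partial>PiM {..<length (Z @ [{n}])} (\<lambda>_. ?S)) \<partial>jeffreys_prior)"
    using AE_jeffreys_prior_pos by (intro nn_integral_mono_AE) (auto elim: eventually_mono)
  then show ?thesis
    using mG by (simp add: marginal_likelihood_rows_eq nn_integral_cmult)
qed


section \<open>Weights of the dimensions\<close>

text \<open>Frees \<open>marginal_likelihood\<close> from its arbitrary choice: two lists with the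
  same multiset differ by a permutation.\<close>

lemma marginal_likelihood_eq_rows:
  fixes y :: "nat \<Rightarrow> real^'d::finite"
  assumes H: "haar_orthogonal H" and len: "length zs \<le> CARD('d)" and Z: "mset zs = Z"
  shows "marginal_likelihood a b H y N Z = marginal_likelihood_rows a b H y N zs"
proof -
  have "mset (SOME zs. mset zs = Z) = mset zs"
    unfolding Z using someI[of "\<lambda>zs. mset zs = Z", OF Z] .
  then obtain p where "p permutes {..<length zs}" "permute_list p zs = (SOME zs. mset zs = Z)"
    by (rule mset_eq_permutation)
  then show ?thesis
    unfolding marginal_likelihood_def using marginal_likelihood_rows_permute[OF H _ len] by metis
qed

lemma marginal_likelihood_add_singleton_ge:
  fixes y :: "nat \<Rightarrow> real^'d::finite"
  assumes H: "haar_orthogonal H" and size: "size Z < CARD('d)" and n: "n \<in> {1..N}"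
  shows "dimension_cost a b * marginal_likelihood a b H y N Z
    \<le> marginal_likelihood a b H y N (add_mset {n} Z)"
proof -
  obtain zs where zs: "mset zs = Z" using ex_mset by blast
  then have len: "length zs < CARD('d)" using size by auto
  show ?thesis
    using marginal_likelihood_rows_add_singleton_ge[OF H len n, of a b y]
      marginal_likelihood_eq_rows[OF H _ zs] marginal_likelihood_eq_rows[OF H, of "zs @ [{n}]" "add_mset {n} Z"]
      zs len by simp
qed

section \<open>Counting matrices and the Indian buffet prior\<close>

lemma finite_histories: "finite (histories N)"
  by (rule finite_subset[of _ "Pow {1..N}"]) (auto simp: histories_def)

lemma finite_binary_matrices: "finite (binary_matrices N k)"
proof (rule finite_subset)
  show "binary_matrices N k \<subseteq> mset ` {zs. set zs \<subseteq> histories N \<and> length zs = k}"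
  proof
    fix Z assume Z: "Z \<in> binary_matrices N k"
    obtain zs where "mset zs = Z" using ex_mset by blast
    then show "Z \<in> mset ` {zs. set zs \<subseteq> histories N \<and> length zs = k}"
      using Z by (auto simp: binary_matrices_def)
  qed
  show "finite (mset ` {zs. set zs \<subseteq> histories N \<and> length zs = k})"
    by (intro finite_imageI finite_lists_length_eq finite_histories)
qed

lemma singleton_in_histories: "n \<in> {1..N} \<Longrightarrow> {n} \<in> histories N"
  by (simp add: histories_def)

lemma add_singleton_in_binary_matrices:
  "Z \<in> binary_matrices N k \<Longrightarrow> n \<in> {1..N} \<Longrightarrow> add_mset {n} Z \<in> binary_matrices N (Suc k)"
  using singleton_in_histories by (auto simp: binary_matrices_def)

text \<open>The new row contributes \<open>\<alpha>\<close> and, having a single one, the factor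
  \<open>(N - 1)! 0! / N! = 1 / N\<close>. The factorial of the multiplicity of \<open>{n}\<close>
  grows by the factor \<open>Suc (count Z {n})\<close>.\<close>

lemma ibp_prior_add_singleton:
  assumes "size Z < D" and n: "n \<in> {1..N}"
  shows "ibp_prior D \<alpha> N (add_mset {n} Z) = ibp_prior D \<alpha> N Z * (\<alpha> / (real N * real (Suc (count Z {n}))))"
proof -
  have h: "{n} \<in> histories N" using n by (rule singleton_in_histories)
  have "(\<Prod>h\<in>histories N. fact (count (add_mset {n} Z) h) :: real)
      = fact (Suc (count Z {n})) * (\<Prod>h\<in>histories N - {{n}}. fact (count Z h))"
  proof -
    have "(\<Prod>h\<in>histories N - {{n}}. fact (count (add_mset {n} Z) h) :: real)
        = (\<Prod>h\<in>histories N - {{n}}. fact (count Z h))"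
      by (intro prod.cong refl) auto
    then show ?thesis by (subst prod.remove[OF finite_histories h]) simp
  qed
  also have "\<dots> = real (Suc (count Z {n})) * (\<Prod>h\<in>histories N. fact (count Z h))"
    by (subst prod.remove[OF finite_histories h]) (simp add: mult.assoc)
  finally have "(\<Prod>h\<in>histories N. fact (count (add_mset {n} Z) h) :: real)
      = real (Suc (count Z {n})) * (\<Prod>h\<in>histories N. fact (count Z h))" .
  moreover have "fact (N - 1) / fact N = (1 / real N :: real)"
    using n by (subst fact_reduce[of N]) auto
  ultimately show ?thesis
    using assms(1) by (simp add: ibp_prior_def mult_ac)
qed

lemma ibp_prior_nonneg: "0 \<le> \<alpha> \<Longrightarrow> 0 \<le> ibp_prior D \<alpha> N Z"
proof -
  assume "0 \<le> \<alpha>"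
  moreover have "0 \<le> (\<Prod>h\<in>#Z. fact (N - card h) * fact (card h - 1) / fact N :: real)"
    by (induction Z) auto
  ultimately show ?thesis by (auto simp: ibp_prior_def intro!: mult_nonneg_nonneg divide_nonneg_nonneg prod_nonneg)
qed

text \<open>Double counting: for fixed \<open>n\<close>, adding the row \<open>{n}\<close> is
  injective, and a matrix with \<open>Suc k\<close> rows contains at most \<open>Suc k\<close>
  distinct singletons.\<close>

lemma sum_add_singleton_le:
  fixes w :: "nat set multiset \<Rightarrow> ennreal"
  shows "(\<Sum>n=1..N. \<Sum>Z\<in>binary_matrices N k. w (add_mset {n} Z))
    \<le> of_nat (Suc k) * (\<Sum>Z\<in>binary_matrices N (Suc k). w Z)"
proof -
  let ?B = "binary_matrices N (Suc k)"
  have "(\<Sum>Z\<in>binary_matrices N k. w (add_mset {n} Z)) \<le> (\<Sum>Z\<in>?B. if {n} \<in># Z then w Z else 0)"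
    if n: "n \<in> {1..N}" for n
  proof -
    have "(\<Sum>Z\<in>binary_matrices N k. w (add_mset {n} Z)) = sum w (add_mset {n} ` binary_matrices N k)"
      by (subst sum.reindex) (auto simp: inj_on_def)
    also have "\<dots> \<le> sum w {Z \<in> ?B. {n} \<in># Z}"
      using n finite_binary_matrices add_singleton_in_binary_matrices by (intro sum_mono2) auto
    also have "\<dots> = (\<Sum>Z\<in>?B. if {n} \<in># Z then w Z else 0)"
      using finite_binary_matrices by (simp add: sum.inter_filter)
    finally show ?thesis .
  qed
  then have "(\<Sum>n=1..N. \<Sum>Z\<in>binary_matrices N k. w (add_mset {n} Z))
      \<le> (\<Sum>n=1..N. \<Sum>Z\<in>?B. if {n} \<in># Z then w Z else 0)"
    by (rule sum_mono)
  also have "\<dots> = (\<Sum>Z\<in>?B. \<Sum>n=1..N. if {n} \<in># Z then w Z else 0)"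
    by (rule sum.swap)
  also have "\<dots> \<le> (\<Sum>Z\<in>?B. of_nat (Suc k) * w Z)"
  proof (rule sum_mono)
    fix Z assume Z: "Z \<in> ?B"
    have "card {n \<in> {1..N}. {n} \<in># Z} = card ((\<lambda>n. {n}) ` {n \<in> {1..N}. {n} \<in># Z})"
      by (subst card_image) (auto simp: inj_on_def)
    also have "\<dots> \<le> card (set_mset Z)" by (intro card_mono) auto
    also have "\<dots> \<le> size Z" by (simp add: size_multiset_overloaded_eq card_eq_sum del: sum_constant)
        (intro sum_mono, simp add: Suc_le_eq)
    also have "\<dots> = Suc k" using Z by (simp add: binary_matrices_def)
    finally have "(of_nat (card {n \<in> {1..N}. {n} \<in># Z}) :: ennreal) \<le> of_nat (Suc k)"
      by (simp only: of_nat_le_iff)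
    moreover have "(\<Sum>n=1..N. if {n} \<in># Z then w Z else 0) = of_nat (card {n \<in> {1..N}. {n} \<in># Z}) * w Z"
      by (subst sum.inter_filter[symmetric]) auto
    ultimately show "(\<Sum>n=1..N. if {n} \<in># Z then w Z else 0) \<le> of_nat (Suc k) * w Z"
      by (simp add: mult_right_mono)
  qed
  finally show ?thesis by (simp only: sum_distrib_left)
qed

text \<open>The bounds on likelihood and prior are multiplied term by term and summed over
  \<open>Z\<close> and \<open>n\<close>. The factor \<open>Suc k\<close> on the left bounds a
  multiplicity in the prior, the one on the right comes from the double counting.\<close>

lemma dimension_weight_Suc_ge:
  fixes y :: "nat \<Rightarrow> real^'d::finite"
  assumes \<alpha>: "0 < \<alpha>" and H: "haar_orthogonal H" and k: "k < CARD('d)" and N: "1 \<le> N"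
  shows "dimension_cost a b * ennreal (\<alpha> / Suc k) * dimension_weight \<alpha> a b H y N k
    \<le> of_nat (Suc k) * dimension_weight \<alpha> a b H y N (Suc k)"
proof -
  define w where "w Z = ennreal (ibp_prior CARD('d) \<alpha> N Z) * marginal_likelihood a b H y N Z" for Z
  let ?c = "dimension_cost a b" and ?q = "ennreal (\<alpha> / (real N * Suc k))"
  have w: "?c * ?q * w Z \<le> w (add_mset {n} Z)" if n: "n \<in> {1..N}" and Z: "Z \<in> binary_matrices N k" for n Z
  proof -
    have size: "size Z = k" using Z by (simp add: binary_matrices_def)
    have "\<alpha> / (real N * Suc k) \<le> \<alpha> / (real N * real (Suc (count Z {n})))"
      using \<alpha> N count_le_size[of Z "{n}"] size by (intro divide_left_mono mult_left_mono) auto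
    then have "ibp_prior CARD('d) \<alpha> N Z * (\<alpha> / (real N * Suc k)) \<le> ibp_prior CARD('d) \<alpha> N (add_mset {n} Z)"
      unfolding ibp_prior_add_singleton[OF k[folded size] n]
      by (rule mult_left_mono) (use \<alpha> in \<open>simp add: ibp_prior_nonneg\<close>)
    then have "ennreal (ibp_prior CARD('d) \<alpha> N Z) * ?q \<le> ennreal (ibp_prior CARD('d) \<alpha> N (add_mset {n} Z))"
      using ibp_prior_nonneg[of \<alpha>] \<alpha> by (simp add: ennreal_mult[symmetric] ennreal_leI)
    then have "(ennreal (ibp_prior CARD('d) \<alpha> N Z) * ?q) * (?c * marginal_likelihood a b H y N Z) \<le> w (add_mset {n} Z)"
      unfolding w_def using marginal_likelihood_add_singleton_ge[OF H, of Z n N a b y] k size n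
      by (intro mult_mono) auto
    then show ?thesis unfolding w_def by (simp only: mult_ac)
  qed
  \<comment> \<open>The \<open>N\<close> choices of \<open>n\<close> cancel the \<open>1 / N\<close>
    of the prior, which makes the comparison uniform in \<open>N\<close>.\<close>
  have "of_nat N * ?q = ennreal (\<alpha> / Suc k)"
    using \<alpha> N by (simp add: ennreal_of_nat_eq_real_of_nat ennreal_mult'[symmetric] del: of_nat_Suc)
  then have "?c * ennreal (\<alpha> / Suc k) * dimension_weight \<alpha> a b H y N k
      = of_nat N * (?c * ?q * dimension_weight \<alpha> a b H y N k)"
    by (metis mult.assoc mult.left_commute)
  also have "\<dots> = (\<Sum>n=1..N. \<Sum>Z\<in>binary_matrices N k. ?c * ?q * w Z)"
    by (simp add: dimension_weight_def w_def sum_distrib_left)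
  also have "\<dots> \<le> (\<Sum>n=1..N. \<Sum>Z\<in>binary_matrices N k. w (add_mset {n} Z))"
    by (intro sum_mono w)
  also have "\<dots> \<le> of_nat (Suc k) * dimension_weight \<alpha> a b H y N (Suc k)"
    unfolding dimension_weight_def w_def[symmetric] by (rule sum_add_singleton_le)
  finally show ?thesis .
qed

lemma dimension_weight_le_Suc:
  fixes y :: "nat \<Rightarrow> real^'d::finite"
  assumes "0 < \<alpha>" "0 < a" "0 < b" and H: "haar_orthogonal H" and k: "k < CARD('d)"
  shows "\<exists>C>0. \<forall>N\<ge>1. dimension_weight \<alpha> a b H y N k \<le> ennreal C * dimension_weight \<alpha> a b H y N (Suc k)"
proof -
  \<comment> \<open>Capping at 1 makes the constant a real number \<open>r\<close>, so that division
    by it is possible in \<open>ennreal\<close>.\<close>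
  define q where "q = min 1 (dimension_cost a b * ennreal (\<alpha> / Suc k))"
  have "q \<noteq> 0" using assms dimension_cost_pos[of a b] by (auto simp: q_def min_def)
  moreover have "q < \<top>" unfolding q_def by (rule le_less_trans[of _ 1]) auto
  ultimately obtain r where r: "q = ennreal r" "0 < r"
    by (cases q) (auto simp: ennreal_eq_0_iff less_le)
  have "dimension_weight \<alpha> a b H y N k \<le> ennreal (Suc k / r) * dimension_weight \<alpha> a b H y N (Suc k)" if "1 \<le> N" for N
  proof -
    have "ennreal r * dimension_weight \<alpha> a b H y N k \<le> of_nat (Suc k) * dimension_weight \<alpha> a b H y N (Suc k)"
      unfolding r(1)[symmetric] using dimension_weight_Suc_ge[OF assms(1) H k that, of a b y]
      by (rule order_trans[rotated]) (intro mult_right_mono, simp_all add: q_def)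
    then have "ennreal (1 / r) * (ennreal r * dimension_weight \<alpha> a b H y N k)
        \<le> ennreal (1 / r) * (ennreal (Suc k) * dimension_weight \<alpha> a b H y N (Suc k))"
      unfolding ennreal_of_nat_eq_real_of_nat by (rule mult_left_mono) simp
    then show ?thesis
      using r(2) by (simp add: mult.assoc[symmetric] ennreal_mult[symmetric] del: of_nat_Suc)
  qed
  then show ?thesis using r(2) by (intro exI[of _ "Suc k / r"]) simp
qed

text \<open>The one-step comparisons are chained downwards from D; their constants multiply and stay
  independent of \<open>N\<close>.\<close>

lemma dimension_weight_le_full:
  fixes y :: "nat \<Rightarrow> real^'d::finite"
  assumes "0 < \<alpha>" "0 < a" "0 < b" and H: "haar_orthogonal H" and "k \<le> CARD('d)"
  shows "\<exists>C>0. \<forall>N\<ge>1. dimension_weight \<alpha> a b H y N k \<le> ennreal C * dimension_weight \<alpha> a b H y N CARD('d)"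
  using \<open>k \<le> CARD('d)\<close>
proof (induction k rule: inc_induct)
  case base
  show ?case by (intro exI[of _ 1]) simp
next
  case (step k)
  obtain C where C: "C > 0" "\<And>N. 1 \<le> N \<Longrightarrow>
      dimension_weight \<alpha> a b H y N (Suc k) \<le> ennreal C * dimension_weight \<alpha> a b H y N CARD('d)"
    using step.IH by auto
  obtain C' where C': "C' > 0" "\<And>N. 1 \<le> N \<Longrightarrow>
      dimension_weight \<alpha> a b H y N k \<le> ennreal C' * dimension_weight \<alpha> a b H y N (Suc k)"
    using dimension_weight_le_Suc[OF assms(1-4) step.hyps(2)] by blast
  have "dimension_weight \<alpha> a b H y N k \<le> ennreal (C' * C) * dimension_weight \<alpha> a b H y N CARD('d)" if "1 \<le> N" for N
  proof -
    have "dimension_weight \<alpha> a b H y N k \<le> ennreal C' * (ennreal C * dimension_weight \<alpha> a b H y N CARD('d))"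
      using C'(2)[OF that] mult_left_mono[OF C(2)[OF that], of "ennreal C'"] by (rule order_trans) simp
    then show ?thesis using C(1) C'(1) by (simp add: ennreal_mult mult.assoc)
  qed
  then show ?case using C(1) C'(1) by (intro exI[of _ "C' * C"]) simp
qed

lemma evidence_le_full_dimension:
  fixes y :: "nat \<Rightarrow> real^'d::finite"
  assumes "0 < \<alpha>" "0 < a" "0 < b" and H: "haar_orthogonal H"
  shows "\<exists>C>0. \<forall>N\<ge>1. evidence \<alpha> a b H y N \<le> ennreal C * dimension_weight \<alpha> a b H y N CARD('d)"
proof -
  have "\<forall>k\<in>{0..CARD('d)}. \<exists>C>0. \<forall>N\<ge>1.
      dimension_weight \<alpha> a b H y N k \<le> ennreal C * dimension_weight \<alpha> a b H y N CARD('d)"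
    using dimension_weight_le_full[OF assms] by simp
  then obtain C where C: "\<And>k. k \<in> {0..CARD('d)} \<Longrightarrow> C k > 0"
    "\<And>k N. k \<in> {0..CARD('d)} \<Longrightarrow> 1 \<le> N \<Longrightarrow>
      dimension_weight \<alpha> a b H y N k \<le> ennreal (C k) * dimension_weight \<alpha> a b H y N CARD('d)"
    by metis
  have "evidence \<alpha> a b H y N \<le> ennreal (\<Sum>k=0..CARD('d). C k) * dimension_weight \<alpha> a b H y N CARD('d)" if "1 \<le> N" for N
  proof -
    have "evidence \<alpha> a b H y N \<le> (\<Sum>k=0..CARD('d). ennreal (C k) * dimension_weight \<alpha> a b H y N CARD('d))"
      unfolding evidence_def by (intro sum_mono C(2) that)
    also have "\<dots> = ennreal (\<Sum>k=0..CARD('d). C k) * dimension_weight \<alpha> a b H y N CARD('d)"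
      unfolding sum_distrib_right[symmetric] using C(1) by (subst sum_ennreal) (auto intro: less_imp_le)
    finally show ?thesis .
  qed
  moreover have "0 < (\<Sum>k=0..CARD('d). C k)" using C(1) by (intro sum_pos) auto
  ultimately show ?thesis by blast
qed

theorem theorem1:
  fixes \<alpha> a\<^sub>\<delta> b\<^sub>\<delta> :: real
    and H :: "(real^'d^'d) measure"
    and y :: "nat \<Rightarrow> real^'d::finite"
  assumes "\<alpha> > 0" and "a\<^sub>\<delta> > 0" and "b\<^sub>\<delta> > 0"
    and "haar_orthogonal H"
    and "\<And>N. N \<ge> 1 \<Longrightarrow> 0 < evidence \<alpha> a\<^sub>\<delta> b\<^sub>\<delta> H y N \<and> evidence \<alpha> a\<^sub>\<delta> b\<^sub>\<delta> H y N < \<infinity>"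
  shows "(\<forall>k<CARD('d). limsup (\<lambda>N. posterior_dimension \<alpha> a\<^sub>\<delta> b\<^sub>\<delta> H y N k) < 1) \<and>
         limsup (\<lambda>N. posterior_dimension \<alpha> a\<^sub>\<delta> b\<^sub>\<delta> H y N CARD('d)) > 0"
proof -
  let ?E = "evidence \<alpha> a\<^sub>\<delta> b\<^sub>\<delta> H y" and ?W = "dimension_weight \<alpha> a\<^sub>\<delta> b\<^sub>\<delta> H y"
  let ?P = "posterior_dimension \<alpha> a\<^sub>\<delta> b\<^sub>\<delta> H y"
  obtain C where C: "C > 0" "\<And>N. 1 \<le> N \<Longrightarrow> ?E N \<le> ennreal C * ?W N CARD('d)"
    using evidence_le_full_dimension[OF assms(1-4)] by blast
  have bounds: "ennreal (1 / C) \<le> ?P N CARD('d)"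
      "k < CARD('d) \<Longrightarrow> ?P N k \<le> ennreal (1 - 1 / C)" if N: "1 \<le> N" for N k
  proof -
    \<comment> \<open>Applied to \<open>{k}\<close> for finiteness of a weight, and to
      \<open>{k, CARD('d)}\<close> for the upper bound.\<close>
    have W_le: "sum (?W N) K \<le> ?E N" if "K \<subseteq> {0..CARD('d)}" for K
      unfolding evidence_def using that by (intro sum_mono2) auto
    have W_top: "?W N k < \<top>" if "k \<le> CARD('d)" for k
      using W_le[of "{k}"] that assms(5)[OF N] by (auto simp: less_top[symmetric] top_unique)
    define e where "e = enn2real (?E N)"
    define w where "w k = enn2real (?W N k)" for k
    \<comment> \<open>Since the evidence is positive and finite, the quotients in
      \<open>ennreal\<close> become quotients of reals.\<close>
    have e: "?E N = ennreal e" "0 < e"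
      using assms(5)[OF N] by (auto simp: e_def enn2real_positive_iff)
    have w: "?W N k = ennreal (w k)" "0 \<le> w k" if "k \<le> CARD('d)" for k
      using W_top[OF that] by (auto simp: w_def)
    have "e \<le> C * w CARD('d)"
      using C(2)[OF N] C(1) w[of "CARD('d)"] e by (simp add: ennreal_mult[symmetric])
    then have full: "1 / C \<le> w CARD('d) / e" using C(1) e(2) by (simp add: field_simps)
    then show "ennreal (1 / C) \<le> ?P N CARD('d)"
      using w[of "CARD('d)"] e by (simp add: posterior_dimension_def divide_ennreal ennreal_leI)
    show "?P N k \<le> ennreal (1 - 1 / C)" if k: "k < CARD('d)"
    proof -
      \<comment> \<open>The masses at \<open>k\<close> and at D are disjoint parts of the evidence,
        so the share \<open>1 / C\<close> held by D is lost to \<open>k\<close>.\<close>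
      have "ennreal (w k + w CARD('d)) \<le> ennreal e"
        using W_le[of "{k, CARD('d)}"] k w[of k] w[of "CARD('d)"] e(1) by simp
      then have "w k + w CARD('d) \<le> e" using e(2) by simp
      then have "w k / e + w CARD('d) / e \<le> 1"
        using e(2) by (simp add: add_divide_distrib[symmetric])
      then have "w k / e \<le> 1 - 1 / C" using full by simp
      then show ?thesis
        using w[of k] k e by (simp add: posterior_dimension_def divide_ennreal ennreal_leI)
    qed
  qed
  have ev: "\<forall>\<^sub>F N in sequentially. 1 \<le> N" by (rule eventually_ge_at_top)
  show ?thesis
  proof (intro conjI allI impI)
    fix k assume k: "k < CARD('d)"
    have "limsup (\<lambda>N. ?P N k) \<le> ennreal (1 - 1 / C)"
      by (intro Limsup_bounded eventually_mono[OF ev] bounds(2) k)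
    also have "\<dots> < 1" using C(1) by (simp add: ennreal_lessI flip: ennreal_1)
    finally show "limsup (\<lambda>N. ?P N k) < 1" .
  next
    have "0 < ennreal (1 / C)" using C(1) by simp
    also have "\<dots> \<le> limsup (\<lambda>N. ?P N CARD('d))"
      by (intro le_Limsup eventually_mono[OF ev] bounds(1)) simp_all
    finally show "0 < limsup (\<lambda>N. ?P N CARD('d))" .
  qed
qed

end
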